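(* Let $n\ge 1$ and let $P$ be a polyhedron that is a $\mathbb{Z}$-retract of $[0,1]^n$. Then: (i) $P$ is contractible; (ii) $P$ contains a vertex of $[0,1]^n$; and (iii) $P$ has a strongly regular triangulation.
   Context: A polyhedron in $[0,1]^n$ is a finite union of (closed) simplexes contained in $[0,1]^n$; it is rational if the simplexes can be chosen with rational vertices. A triangulation of a polyhedron $P$ is a finite simplicial complex $\Delta$ (of closed simplexes) whose point-set union $|\Delta|$ is $P$. $\mathbb{Z}$-maps and $\mathbb{Z}$-retracts: for rational polyhedra $P\subseteq[0,1]^n$, $Q\subseteq[0,1]^m$, a map $\eta\colon P\to Q$ is a $\mathbb{Z}$-map if there is a triangulation $\mathcal K$ of $P$ such that on every simplex $T\in\mathcal K$, $\eta$ coincides with an (affine) linear map with integer coefficients, i.e. $x\mapsto Mx+b$ with $M\in\mathbb{Z}^{m\times n}$, $b\in\mathbb{Z}^m$. A $\mathbb{Z}$-retraction of $P$ is a $\mathbb{Z}$-map $\sigma\colon P\to P$ with $\sigma\circ\sigma=\sigma$; the set $\sigma(P)$ is then called a $\mathbb{Z}$-retract of $P$. Regularity: for a rational point $v\in\mathbb{R}^n$, $\operatorname{den}(v)$ is the least common denominator of the coordinates of $v$, and $\widetilde v=\operatorname{den}(v)(v,1)\in\mathbb{Z}^{n+1}$. A simplex $\operatorname{conv}(w_0,\dots,w_m)\subseteq[0,1]^n$ is regular if its vertices are rational and $\{\widetilde{w_0},\dots,\widetilde{w_m}\}$ can be extended to a basis of the free abelian group $\mathbb{Z}^{n+1}$.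 A triangulation is regular if all its simplexes are regular. It is strongly regular if it is regular and, for each of its maximal simplexes, the greatest common divisor of the denominators of the vertices of that simplex is $1$. *)

theory Defs
  imports "HOL-Analysis.Analysis"
begin

abbreviation unit_cube :: "(real ^ 'n) set"
  where "unit_cube \<equiv> cbox 0 1"

abbreviation vertices :: "(real ^ 'n) set \<Rightarrow> (real ^ 'n) set"
  where "vertices S \<equiv> {v. v extreme_point_of S}"

definition rational_point :: "real ^ 'n \<Rightarrow> bool"
  where "rational_point v \<longleftrightarrow> (\<forall>i. v $ i \<in> \<rat>)"


(* These are the (possibly non-convex) compact polyhedra of piecewise-linear topology;
   the library constant polyhedron is the unrelated notion of a finite intersection of
   half-spaces. *)

definition cube_polyhedron :: "(real ^ 'n) set \<Rightarrow> bool"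
  where "cube_polyhedron P \<longleftrightarrow>
    (\<exists>F. finite F \<and> (\<forall>S\<in>F. (\<exists>k. k simplex S) \<and> S \<subseteq> unit_cube) \<and> P = \<Union>F)"

definition rational_cube_polyhedron :: "(real ^ 'n) set \<Rightarrow> bool"
  where "rational_cube_polyhedron P \<longleftrightarrow>
    (\<exists>F. finite F \<and>
         (\<forall>S\<in>F. (\<exists>k. k simplex S) \<and> S \<subseteq> unit_cube \<and> (\<forall>v\<in>vertices S. rational_point v)) \<and>
         P = \<Union>F)"

(* A library simplicial_complex is closed under all faces, including the empty one, which
   is the (-1)-simplex.  The empty face satisfies the conditions imposed on simplexes below
   trivially, and it is not maximal when P is nonempty. *)

definition triangulates :: "(real ^ 'n) set set \<Rightarrow> (real ^ 'n) set \<Rightarrow> bool"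
  where "triangulates K P \<longleftrightarrow> simplicial_complex K \<and> \<Union>K = P"


definition integer_affine_on :: "(real ^ 'n) set \<Rightarrow> (real ^ 'n \<Rightarrow> real ^ 'm) \<Rightarrow> bool"
  where "integer_affine_on T \<eta> \<longleftrightarrow>
    (\<exists>(M :: real ^ 'n ^ 'm) (b :: real ^ 'm).
       (\<forall>i j. M $ i $ j \<in> \<int>) \<and> (\<forall>i. b $ i \<in> \<int>) \<and> (\<forall>x\<in>T. \<eta> x = M *v x + b))"

(* Only the values of the total function \<eta> on P matter. *)

definition Z_map ::
    "(real ^ 'n) set \<Rightarrow> (real ^ 'm) set \<Rightarrow> (real ^ 'n \<Rightarrow> real ^ 'm) \<Rightarrow> bool"
  where "Z_map P Q \<eta> \<longleftrightarrow>
    rational_cube_polyhedron P \<and> rational_cube_polyhedron Q \<and> \<eta> ` P \<subseteq> Q \<and>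
    (\<exists>K. triangulates K P \<and> (\<forall>T\<in>K. integer_affine_on T \<eta>))"

definition Z_retraction :: "(real ^ 'n) set \<Rightarrow> (real ^ 'n \<Rightarrow> real ^ 'n) \<Rightarrow> bool"
  where "Z_retraction P \<sigma> \<longleftrightarrow> Z_map P P \<sigma> \<and> (\<forall>x\<in>P. \<sigma> (\<sigma> x) = \<sigma> x)"

definition Z_retract_of :: "(real ^ 'n) set \<Rightarrow> (real ^ 'n) set \<Rightarrow> bool"
  where "Z_retract_of R P \<longleftrightarrow> (\<exists>\<sigma>. Z_retraction P \<sigma> \<and> R = \<sigma> ` P)"


(* den and homogeneous are meaningful for rational points only; there the multiples
   den v * v$i are integers, so floor merely converts the type. *)

definition den :: "real ^ 'n \<Rightarrow> nat"
  where "den v = (LEAST d. 0 < d \<and> (\<forall>i. real d * v $ i \<in> \<int>))"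

(* The vector den v * (v, 1): the index None plays the role of the additional last
   coordinate n + 1. *)

definition homogeneous :: "real ^ 'n \<Rightarrow> int ^ ('n option)"
  where "homogeneous v =
    (\<chi> j. case j of None \<Rightarrow> int (den v) | Some i \<Rightarrow> \<lfloor>real (den v) * v $ i\<rfloor>)"

global_interpretation int_vec: module "(*s) :: int \<Rightarrow> int ^ 'k \<Rightarrow> int ^ 'k"
  by unfold_locales (auto simp: vec_eq_iff algebra_simps)

definition Z_basis :: "(int ^ 'k) set \<Rightarrow> bool"
  where "Z_basis B \<longleftrightarrow> int_vec.independent B \<and> int_vec.span B = UNIV"

definition regular_simplex :: "(real ^ 'n) set \<Rightarrow> bool"
  where "regular_simplex S \<longleftrightarrow>
    (\<exists>k. k simplex S) \<and> S \<subseteq> unit_cube \<and> (\<forall>v\<in>vertices S. rational_point v) \<and>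
    (\<exists>B. homogeneous ` vertices S \<subseteq> B \<and> Z_basis B)"

definition regular_triangulation :: "(real ^ 'n) set set \<Rightarrow> (real ^ 'n) set \<Rightarrow> bool"
  where "regular_triangulation K P \<longleftrightarrow> triangulates K P \<and> (\<forall>S\<in>K. regular_simplex S)"

definition strongly_regular_triangulation :: "(real ^ 'n) set set \<Rightarrow> (real ^ 'n) set \<Rightarrow> bool"
  where "strongly_regular_triangulation K P \<longleftrightarrow>
    regular_triangulation K P \<and>
    (\<forall>S\<in>K. (\<forall>T\<in>K. S \<subseteq> T \<longrightarrow> T = S) \<longrightarrow> Gcd (den ` vertices S) = 1)"

end

theory Submission
  imports Defs "HOL-Library.Multiset"
begin

text \<open>
  A retraction \<open>\<sigma>\<close> of the cube makes \<open>P\<close> the set of fixed points of \<open>\<sigma>\<close>, and contractibility is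
  inherited from the cube. Integer points go to integer points, so \<open>\<sigma> 0\<close> is a vertex of the cube.

  The displacement \<open>\<sigma> x - x\<close> is given locally by finitely many integer affine forms, so \<open>P\<close> is a
  union of cells of an integer hyperplane arrangement. In homogeneous coordinates, start from the
  cone spanned by the standard basis of \<open>\<int>\<^sup>n\<^sup>+\<^sup>1\<close>, which contains the cone over the cube, and star
  repeatedly at Farey mediants \<open>v + w\<close> of edges cut by a hyperplane. This keeps all cones unimodular
  and, choosing edges of maximal variation, ends with a fan that refines the arrangement. The cones
  over simplexes inside \<open>P\<close> form a regular triangulation.

  Any such triangulation is strongly regular: an open part of each maximal simplex is reached by
  \<open>\<sigma>\<close> from points of denominator dividing \<open>q\<close>, for every large \<open>q\<close>, and \<open>\<sigma>\<close> does not
  enlarge denominators; by unimodularity the greatest common divisor of the vertex denominators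
  divides \<open>q\<close>.
\<close>

section \<open>Integral linear forms and the embedding of the integer lattice into real
  space\<close>

definition ipair :: "int ^ 'k \<Rightarrow> int ^ 'k \<Rightarrow> int"
  where "ipair h v = (\<Sum>j\<in>UNIV. h $ j * v $ j)"

definition rvec :: "int ^ 'k \<Rightarrow> real ^ 'k"
  where "rvec v = (\<chi> j. of_int (v $ j))"

lemma rvec_nth [simp]: "rvec v $ j = of_int (v $ j)"
  by (simp add: rvec_def)

lemma inner_rvec: "rvec h \<bullet> rvec v = of_int (ipair h v)"
  by (simp add: ipair_def inner_vec_def)

lemma rvec_add: "rvec (v + w) = rvec v + rvec w"
  by (simp add: vec_eq_iff)

lemma ipair_add: "ipair h (v + w) = ipair h v + ipair h w"
  by (simp add: ipair_def algebra_simps sum.distrib)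

lemma ipair_zero [simp]: "ipair h 0 = 0"
  by (simp add: ipair_def)

subsection \<open>Parts of bases of the integer lattice\<close>

text \<open>Finiteness of \<open>B\<close> is recorded so that independence and span can be handled
  through sums over all of \<open>B\<close>.\<close>

definition unimodular :: "(int ^ 'k) set \<Rightarrow> bool"
  where "unimodular A \<longleftrightarrow> (\<exists>B. A \<subseteq> B \<and> finite B \<and> Z_basis B)"

lemma unimodular_subset: "unimodular A \<Longrightarrow> A' \<subseteq> A \<Longrightarrow> unimodular A'"
  unfolding unimodular_def by blast

lemma unimodular_finite: "unimodular A \<Longrightarrow> finite A"
  unfolding unimodular_def using finite_subset by blast

lemma Z_basis_finite_iff:
  fixes B :: "(int ^ 'k) set"
  assumes "finite B"
  shows "Z_basis B \<longleftrightarrow>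
    (\<forall>c. (\<Sum>b\<in>B. c b *s b) = 0 \<longrightarrow> (\<forall>b\<in>B. c b = 0)) \<and> int_vec.span B = UNIV"
  by (auto simp: Z_basis_def int_vec.dependent_finite[OF assms])

lemma sum_axis: "(\<Sum>j\<in>UNIV. f j *s axis j 1) = ((\<chi> j. f j) :: int ^ 'k)"
  by (simp add: vec_eq_iff axis_def if_distrib cong: if_cong)

text \<open>The coefficients of the standard basis vectors in a basis containing \<open>A\<close>
  assemble into integral coordinate functionals; \<open>d v\<close> is the one belonging to
  \<open>v\<close>. Their integrality drives all later divisibility arguments.\<close>

lemma unimodular_dual:
  fixes A :: "(int ^ 'k) set"
  assumes "unimodular A"
  obtains d where "\<And>v w. v \<in> A \<Longrightarrow> w \<in> A \<Longrightarrow> ipair (d v) w = (if v = w then 1 else 0)"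
proof -
  obtain B where B: "A \<subseteq> B" "finite B" "Z_basis B"
    using assms unfolding unimodular_def by blast
  have ind: "\<And>c. (\<Sum>b\<in>B. c b *s b) = 0 \<Longrightarrow> \<forall>b\<in>B. c b = 0"
    and span: "int_vec.span B = UNIV"
    using B by (auto simp: Z_basis_finite_iff)
  have "\<exists>c. (\<Sum>b\<in>B. c b *s b) = axis j 1" for j :: 'k
  proof -
    have "axis j 1 \<in> int_vec.span B"
      using span by simp
    then show ?thesis
      unfolding int_vec.span_finite[OF B(2)] by force
  qed
  then obtain c where c: "\<And>j. (\<Sum>b\<in>B. c j b *s b) = axis j 1"
    by metis
  define d where "d b = (\<chi> j. c j b)" for b
  have "ipair (d v) w = (if v = w then 1 else 0)" if "v \<in> B" "w \<in> B" for v w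
  proof -
    have "w = (\<Sum>j\<in>UNIV. w $ j *s axis j 1)"
      by (simp add: sum_axis vec_eq_iff)
    also have "\<dots> = (\<Sum>j\<in>UNIV. \<Sum>b\<in>B. (w $ j * c j b) *s b)"
      by (simp add: c[symmetric] int_vec.scale_sum_right)
    also have "\<dots> = (\<Sum>b\<in>B. ipair (d b) w *s b)"
      by (subst sum.swap) (simp add: ipair_def d_def int_vec.scale_sum_left mult.commute)
    finally have "w = (\<Sum>b\<in>B. ipair (d b) w *s b)" .
    moreover have "(\<Sum>b\<in>B. (if b = w then 1 else 0) *s b) = w"
      using that B(2) by (subst sum.remove[of _ w]) (auto intro!: sum.neutral)
    ultimately have "(\<Sum>b\<in>B. (ipair (d b) w - (if b = w then 1 else 0)) *s b) = 0"
      by (simp add: int_vec.scale_left_diff_distrib sum_subtractf)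
    from ind[OF this] that show ?thesis by auto
  qed
  then show ?thesis
    using that B(1) by blast
qed

lemma unimodular_nonzero: "unimodular A \<Longrightarrow> v \<in> A \<Longrightarrow> v \<noteq> 0"
  using unimodular_dual[of A] by (metis ipair_zero zero_neq_one)

text \<open>Exchanging \<open>v\<close> for \<open>v + w\<close> is an elementary basis change,
  invertible over the integers. This is why subdividing at mediants keeps cones regular.\<close>

lemma unimodular_insert_add:
  fixes v w :: "int ^ 'k"
  assumes "unimodular (B \<union> {v, w})" "v \<noteq> w" "v \<notin> B"
  shows "unimodular (insert (v + w) B)"
proof -
  obtain D where D: "B \<union> {v, w} \<subseteq> D" "finite D" "Z_basis D"
    using assms unfolding unimodular_def by blast
  have ind: "\<And>c. (\<Sum>b\<in>D. c b *s b) = 0 \<Longrightarrow> \<forall>b\<in>D. c b = 0"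
    and span: "int_vec.span D = UNIV"
    using D by (auto simp: Z_basis_finite_iff)
  define E where "E = insert (v + w) (D - {v})"
  have D2: "D = insert v (insert w (D - {v, w}))" using D by auto
  \<comment> \<open>Otherwise the coordinate functional of \<open>v + w\<close> would be 1 there
    although it vanishes at both \<open>v\<close> and \<open>w\<close>.\<close>
  have new: "v + w \<notin> D"
  proof
    assume vwD: "v + w \<in> D"
    have "unimodular D"
      unfolding unimodular_def using D by blast
    then obtain d where d: "\<And>x y. x \<in> D \<Longrightarrow> y \<in> D \<Longrightarrow> ipair (d x) y = (if x = y then 1 else 0)"
      using unimodular_dual by blast
    have "v \<in> D" "w \<in> D" using D(1) by auto
    then show False
      using d[of "v + w" "v + w"] d[of "v + w" v] d[of "v + w" w] vwD
        unimodular_nonzero[OF \<open>unimodular D\<close>, of v] unimodular_nonzero[OF \<open>unimodular D\<close>, of w]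
      by (auto simp: ipair_add)
  qed
  have "Z_basis E"
  proof (subst Z_basis_finite_iff, goal_cases)
    case 1
    then show ?case using D by (simp add: E_def)
  next
    case 2
    have "\<forall>b\<in>E. c b = 0" if c0: "(\<Sum>b\<in>E. c b *s b) = 0" for c
    proof -
      \<comment> \<open>The coefficients over \<open>D\<close> of a combination over
        \<open>E\<close>: expanding the multiple of \<open>v + w\<close> adds
        \<open>c (v + w)\<close> to the coefficients of both \<open>v\<close> and
        \<open>w\<close>.\<close>
      define c' where "c' b = (if b = v then c (v + w) else if b = w then c w + c (v + w) else c b)" for b
      have fin: "finite (D - {v, w})" using D by simp
      have "(\<Sum>b\<in>D. c' b *s b) = c (v + w) *s v + ((c w + c (v + w)) *s w + (\<Sum>b\<in>D - {v, w}. c' b *s b))"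
        using assms(2) fin by (subst D2) (simp add: c'_def)
      also have "(\<Sum>b\<in>D - {v, w}. c' b *s b) = (\<Sum>b\<in>D - {v, w}. c b *s b)"
        by (intro sum.cong) (auto simp: c'_def)
      also have "c (v + w) *s v + ((c w + c (v + w)) *s w + (\<Sum>b\<in>D - {v, w}. c b *s b))
          = (\<Sum>b\<in>E. c b *s b)"
      proof -
        have "E = insert (v + w) (insert w (D - {v, w}))"
          using D assms(2) by (auto simp: E_def)
        moreover have "v + w \<noteq> w" "v + w \<notin> D - {v, w}"
          using new D(1) by auto
        ultimately show ?thesis
          using fin by (simp add: int_vec.scale_right_distrib int_vec.scale_left_distrib)
      qed
      finally have "(\<Sum>b\<in>D. c' b *s b) = 0" using c0 by simp
      then have z: "\<forall>b\<in>D. c' b = 0" by (rule ind)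
      have "v \<in> D" "w \<in> D" using D(1) by auto
      with z have "c (v + w) = 0" "c w + c (v + w) = 0"
        using assms(2) by (force simp: c'_def)+
      then show ?thesis
        using z by (auto simp: E_def c'_def split: if_splits)
    qed
    moreover have "int_vec.span E = UNIV"
    proof -
      have "w \<in> E" "v + w \<in> E" using D(1) assms(2) by (auto simp: E_def)
      then have "(v + w) - w \<in> int_vec.span E"
        by (intro int_vec.span_diff int_vec.span_base)
      then have "D \<subseteq> int_vec.span E"
        by (auto simp: E_def intro: int_vec.span_base)
      then have "int_vec.span D \<subseteq> int_vec.span E"
        by (intro int_vec.span_minimal int_vec.subspace_span)
      then show ?thesis using span by blast
    qed
    ultimately show ?case by blast
  qed
  moreover have "insert (v + w) B \<subseteq> E" "finite E"
    using D assms(3) by (auto simp: E_def)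
  ultimately show ?thesis
    unfolding unimodular_def by (intro exI[of _ E] conjI)
qed

lemma unimodular_axes: "unimodular (range (\<lambda>j. axis j 1 :: int ^ 'k))"
proof -
  let ?B = "range (\<lambda>j. axis j 1 :: int ^ 'k)"
  have inj: "inj (\<lambda>j. axis j 1 :: int ^ 'k)"
    by (simp add: inj_def axis_eq_axis)
  have comb: "(\<Sum>b\<in>?B. c b *s b) = (\<chi> j. c (axis j 1))" for c
    unfolding sum.reindex[OF inj] o_def by (rule sum_axis)
  have "x \<in> int_vec.span ?B" for x
  proof -
    have "x = (\<Sum>b\<in>?B. x $ (inv (\<lambda>j. axis j 1) b) *s b)"
      unfolding comb by (simp add: inv_f_f[OF inj] vec_eq_iff)
    also have "\<dots> \<in> int_vec.span ?B"
      by (intro int_vec.span_sum int_vec.span_scale int_vec.span_base)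
    finally show ?thesis .
  qed
  then have "Z_basis ?B"
    by (subst Z_basis_finite_iff) (auto simp: comb vec_eq_iff)
  then show ?thesis
    unfolding unimodular_def by (intro exI[of _ ?B] conjI) simp_all
qed

subsection \<open>Regular fans subdividing the orthant\<close>

definition comb :: "(int ^ 'k \<Rightarrow> real) \<Rightarrow> real ^ 'k"
  where "comb c = (\<Sum>v | c v \<noteq> 0. c v *\<^sub>R rvec v)"

definition coords :: "(int ^ 'k) set set \<Rightarrow> (int ^ 'k \<Rightarrow> real) set"
  where "coords C = {c. (\<forall>v. 0 \<le> c v) \<and> {v. c v \<noteq> 0} \<in> C}"

text \<open>A cone is represented by its set of generators and a point by its coefficient function,
  whose support names the cone containing the point in its relative interior. Bijectivity of
  \<open>comb\<close> thus says that the relatively open cones partition the orthant, with unique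
  coordinates; this encodes both covering and correct intersection.\<close>

definition regular_fan :: "(int ^ 'k) set set \<Rightarrow> bool"
  where "regular_fan C \<longleftrightarrow>
    finite C \<and> (\<forall>A\<in>C. unimodular A) \<and> (\<forall>A\<in>C. \<forall>B\<subseteq>A. B \<in> C) \<and>
    bij_betw comb (coords C) {x. \<forall>j. 0 \<le> x $ j}"

lemma comb_eq_sum:
  assumes "finite S" "{v. c v \<noteq> 0} \<subseteq> S"
  shows "comb c = (\<Sum>v\<in>S. c v *\<^sub>R rvec v)"
  unfolding comb_def using assms by (intro sum.mono_neutral_left) auto

lemma comb_restrict:
  assumes "finite A"
  shows "comb (\<lambda>v. if v \<in> A then a v else 0) = (\<Sum>v\<in>A. a v *\<^sub>R rvec v)"
  using assms by (subst comb_eq_sum[of A]) auto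

lemma regular_fan_unimodular: "regular_fan C \<Longrightarrow> A \<in> C \<Longrightarrow> unimodular A"
  and regular_fan_finite: "regular_fan C \<Longrightarrow> finite C"
  and regular_fan_subset: "regular_fan C \<Longrightarrow> A \<in> C \<Longrightarrow> B \<subseteq> A \<Longrightarrow> B \<in> C"
  by (simp_all add: regular_fan_def)

text \<open>Positive coefficients have exactly the generating set as support, so injectivity of
  \<open>comb\<close> identifies the two cones.\<close>

lemma regular_fan_unique:
  assumes C: "regular_fan C" and AB: "A \<in> C" "B \<in> C"
    and pos: "\<And>v. v \<in> A \<Longrightarrow> 0 < a v" "\<And>v. v \<in> B \<Longrightarrow> 0 < b v"
    and eq: "(\<Sum>v\<in>A. a v *\<^sub>R rvec v) = (\<Sum>v\<in>B. b v *\<^sub>R rvec v)"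
  shows "A = B"
proof -
  define a' where "a' v = (if v \<in> A then a v else 0)" for v
  define b' where "b' v = (if v \<in> B then b v else 0)" for v
  have supp: "{v. a' v \<noteq> 0} = A" "{v. b' v \<noteq> 0} = B"
    using pos by (auto simp: a'_def b'_def) (metis less_irrefl)+
  have "a' \<in> coords C" "b' \<in> coords C"
    using supp AB pos by (auto simp: coords_def a'_def b'_def intro: less_imp_le)
  moreover have "comb a' = comb b'"
    using eq AB C by (simp add: a'_def[abs_def] b'_def[abs_def] comb_restrict
        unimodular_finite regular_fan_unimodular)
  moreover have "inj_on comb (coords C)"
    using C by (simp add: regular_fan_def bij_betw_def)
  ultimately have "a' = b'" by (meson inj_onD)
  then show ?thesis using supp by simp
qed

lemma regular_fan_cover:
  assumes "regular_fan C" "\<And>j. 0 \<le> x $ j"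
  obtains A a where "A \<in> C" "\<And>v. v \<in> A \<Longrightarrow> 0 < a v" "x = (\<Sum>v\<in>A. a v *\<^sub>R rvec v)"
proof -
  have "x \<in> comb ` coords C"
    using assms by (auto simp: regular_fan_def bij_betw_def)
  then obtain c where c: "c \<in> coords C" "x = comb c" by auto
  show ?thesis
  proof (rule that)
    show "{v. c v \<noteq> 0} \<in> C" using c by (simp add: coords_def)
    show "0 < c v" if "v \<in> {v. c v \<noteq> 0}" for v
      using c that by (simp add: coords_def order_less_le)
    show "x = (\<Sum>v | c v \<noteq> 0. c v *\<^sub>R rvec v)"
      using c by (simp add: comb_def)
  qed
qed

text \<open>The indicator function of \<open>v\<close> is an admissible coefficient function, and
  \<open>comb\<close> sends it to \<open>rvec v\<close> inside the orthant.\<close>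

lemma regular_fan_nonneg:
  assumes C: "regular_fan C" and "A \<in> C" "v \<in> A"
  shows "0 \<le> v $ j"
proof -
  have "{v} \<in> C" using assms regular_fan_subset by blast
  then have "(\<lambda>w. if w \<in> {v} then 1 else 0) \<in> coords C"
    by (simp add: coords_def)
  then have "comb (\<lambda>w. if w \<in> {v} then 1 else 0) \<in> {x. \<forall>j. 0 \<le> x $ j}"
    using C unfolding regular_fan_def bij_betw_def by blast
  moreover have "comb (\<lambda>w. if w \<in> {v} then 1 else 0) = rvec v"
    by (subst comb_restrict) simp_all
  ultimately show ?thesis by simp
qed

lemma regular_fan_orthant: "regular_fan (Pow (range (\<lambda>j. axis j 1 :: int ^ 'k)))"
proof -
  let ?B = "range (\<lambda>j. axis j 1 :: int ^ 'k)"
  have inj: "inj (\<lambda>j. axis j 1 :: int ^ 'k)"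
    by (simp add: inj_def axis_eq_axis)
  have nth: "comb c $ j = c (axis j 1)" if "c \<in> coords (Pow ?B)" for c j
  proof -
    have "comb c = (\<Sum>b\<in>?B. c b *\<^sub>R rvec b)"
      using that by (intro comb_eq_sum) (auto simp: coords_def)
    also have "\<dots> = (\<Sum>i\<in>UNIV. c (axis i 1) *\<^sub>R rvec (axis i 1))"
      unfolding sum.reindex[OF inj] o_def ..
    finally have "comb c $ j = (\<Sum>i\<in>UNIV. c (axis i 1) * of_int (axis i 1 $ j))"
      by simp
    also have "\<dots> = (\<Sum>i\<in>UNIV. if i = j then c (axis i 1) else 0)"
      by (intro sum.cong) (auto simp: axis_def)
    also have "\<dots> = c (axis j 1)" by simp
    finally show ?thesis .
  qed
  have "bij_betw comb (coords (Pow ?B)) {x. \<forall>j. 0 \<le> x $ j}"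
  proof (rule bij_betw_imageI)
    show "inj_on comb (coords (Pow ?B))"
    proof (rule inj_onI, rule ext)
      fix c d v assume c: "c \<in> coords (Pow ?B)" and d: "d \<in> coords (Pow ?B)" and eq: "comb c = comb d"
      show "c v = d v"
      proof (cases "v \<in> ?B")
        case True
        then show ?thesis using nth[OF c] nth[OF d] eq by auto
      next
        case False
        then have "c v = 0" "d v = 0"
          using c d unfolding coords_def by blast+
        then show ?thesis by simp
      qed
    qed
    show "comb ` coords (Pow ?B) = {x. \<forall>j. 0 \<le> x $ j}"
    proof (intro equalityI subsetI)
      fix x assume "x \<in> comb ` coords (Pow ?B)"
      then obtain c where c: "c \<in> coords (Pow ?B)" "x = comb c" by blast
      then have "0 \<le> c v" for v by (simp add: coords_def)
      then show "x \<in> {x. \<forall>j. 0 \<le> x $ j}"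
        using c nth by auto
    next
      fix x :: "real ^ 'k" assume x: "x \<in> {x. \<forall>j. 0 \<le> x $ j}"
      define c where "c v = (if v \<in> ?B then x $ (inv (\<lambda>j. axis j 1) v) else 0)" for v
      have cB: "c \<in> coords (Pow ?B)"
        using x by (auto simp: coords_def c_def)
      have "c (axis j 1) = x $ j" for j
        by (simp add: c_def inv_f_f[OF inj])
      then have "comb c = x"
        using nth[OF cB] by (simp add: vec_eq_iff)
      with cB show "x \<in> comb ` coords (Pow ?B)" by blast
    qed
  qed
  moreover have "\<forall>A\<in>Pow ?B. unimodular A"
    using unimodular_axes unimodular_subset by blast
  ultimately show ?thesis
    unfolding regular_fan_def by auto
qed

section \<open>Stellar subdivision at the mediant of an edge\<close>

text \<open>Each cone containing the edge \<open>{v, w}\<close> gives way to the cones joining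
  \<open>v + w\<close> to those of its faces that do not contain the edge.\<close>

definition star :: "int ^ 'k \<Rightarrow> int ^ 'k \<Rightarrow> (int ^ 'k) set set \<Rightarrow> (int ^ 'k) set set"
  where "star v w C = {A \<in> C. \<not> {v, w} \<subseteq> A} \<union>
    {insert (v + w) B | B. B \<union> {v, w} \<in> C \<and> \<not> {v, w} \<subseteq> B}"

text \<open>The mediant is interior to the cone on \<open>{v, w}\<close>; as a generator it would
  also be interior to its own ray, against uniqueness.\<close>

lemma mediant_notin:
  assumes C: "regular_fan C" and vw: "{v, w} \<in> C" "v \<noteq> w" and A: "A \<in> C"
  shows "v + w \<notin> A"
proof
  assume "v + w \<in> A"
  then have "{v + w} \<in> C" using regular_fan_subset[OF C A] by blast
  then have "{v + w} = {v, w}"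
    using regular_fan_unique[OF C _ vw(1), of "{v + w}" "\<lambda>_. 1" "\<lambda>_. 1"] vw(2)
    by (simp add: rvec_add)
  then have "v = w" by (metis insert_iff singletonD)
  then show False using vw(2) by simp
qed

text \<open>Old and new coefficient functions correspond bijectively without changing the point they
  describe, so the partition of the orthant is inherited from \<open>C\<close>.\<close>

lemma regular_fan_star:
  fixes C :: "(int ^ 'k) set set"
  assumes C: "regular_fan C" and vw: "{v, w} \<in> C" "v \<noteq> w"
  shows "regular_fan (star v w C)"
proof -
  define u where "u = v + w"
  have uC: "u \<notin> A" if "A \<in> C" for A
    using mediant_notin[OF C vw that] by (simp add: u_def)
  have uvw: "u \<noteq> v" "u \<noteq> w"
    using uC[OF vw(1)] by auto
  have sub: "\<And>A B. A \<in> C \<Longrightarrow> B \<subseteq> A \<Longrightarrow> B \<in> C"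
    using regular_fan_subset[OF C] .
  have star: "star v w C = {A \<in> C. \<not> {v, w} \<subseteq> A} \<union> {insert u B | B. B \<union> {v, w} \<in> C \<and> \<not> {v, w} \<subseteq> B}"
    by (simp add: star_def u_def)
  have starI1: "A \<in> star v w C" if "A \<in> C" "\<not> {v, w} \<subseteq> A" for A
    using that unfolding star by blast
  have starI2: "insert u B \<in> star v w C" if "B \<union> {v, w} \<in> C" "\<not> {v, w} \<subseteq> B" for B
    using that unfolding star by blast
  have uni: "unimodular A" if "A \<in> star v w C" for A
    using that unfolding star
  proof (elim UnE CollectE exE conjE)
    fix B assume B: "A = insert u B" "B \<union> {v, w} \<in> C" "\<not> {v, w} \<subseteq> B"
    \<comment> \<open>The exchange lemma needs the replaced generator outside \<open>B\<close>. At
      least one of \<open>v\<close> and \<open>w\<close> is, hence both orders are prepared.\<close>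
    have "unimodular (B \<union> {v, w})" "unimodular (B \<union> {w, v})"
      using B(2) regular_fan_unimodular[OF C] by (auto simp: insert_commute)
    then show "unimodular A"
      using B unimodular_insert_add[of B v w] unimodular_insert_add[of B w v] vw(2)
      by (auto simp: u_def add.commute)
  qed (use regular_fan_unimodular[OF C] in blast)
  have down: "B \<in> star v w C" if "A \<in> star v w C" "B \<subseteq> A" for A B
    using that(1)[unfolded star]
  proof (elim UnE CollectE exE conjE)
    assume "A \<in> C" "\<not> {v, w} \<subseteq> A"
    then show "B \<in> star v w C"
      using that(2) sub[of A B] by (intro starI1) auto
  next
    fix A' assume A': "A = insert u A'" "A' \<union> {v, w} \<in> C" "\<not> {v, w} \<subseteq> A'"
    have le: "B - {u} \<subseteq> A'" using A' that(2) by auto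
    have m1: "(B - {u}) \<union> {v, w} \<in> C"
      using sub[OF A'(2), of "(B - {u}) \<union> {v, w}"] le by blast
    from this have m2: "B - {u} \<in> C"
      using sub[of _ "B - {u}"] by blast
    have m3: "\<not> {v, w} \<subseteq> B - {u}"
      using le A'(3) by blast
    show "B \<in> star v w C"
      using starI1[OF m2 m3] starI2[OF m1 m3] by (cases "u \<in> B") (simp_all add: insert_absorb)
  qed
  have fin: "finite (star v w C)"
  proof -
    have fC: "finite C" using C by (simp add: regular_fan_def)
    then have "finite (\<Union>C)"
      using regular_fan_unimodular[OF C] unimodular_finite by blast
    moreover have "star v w C \<subseteq> Pow (insert u (\<Union>C))"
      unfolding star by blast
    ultimately show ?thesis by (meson finite_Pow_iff finite_insert finite_subset)
  qed
  \<comment> \<open>\<open>f\<close> distributes the coefficient of \<open>u = v + w\<close> to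
    \<open>v\<close> and \<open>w\<close>; its inverse \<open>g\<close> collects their common part,
    the minimum, at \<open>u\<close>.\<close>
  define f :: "(int ^ 'k \<Rightarrow> real) \<Rightarrow> int ^ 'k \<Rightarrow> real"
    where "f c x = (if x = u then 0 else if x = v \<or> x = w then c x + c u else c x)" for c x
  define g :: "(int ^ 'k \<Rightarrow> real) \<Rightarrow> int ^ 'k \<Rightarrow> real"
    where "g c x = (if x = u then min (c v) (c w)
      else if x = v \<or> x = w then c x - min (c v) (c w) else c x)" for c x
  have f_in: "f c \<in> coords C" and gf: "g (f c) = c" and comb_f: "comb (f c) = comb c"
    if c: "c \<in> coords (star v w C)" for c
  proof -
    have nn: "\<And>x. 0 \<le> c x" and supp: "{x. c x \<noteq> 0} \<in> star v w C"
      using c by (auto simp: coords_def)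
    \<comment> \<open>In a new cone at most one of \<open>v\<close> and \<open>w\<close> carries a
      positive coefficient, so after distribution the minimum recovers the coefficient of
      \<open>u\<close>.\<close>
    have main: "{x. f c x \<noteq> 0} \<in> C \<and> min (f c v) (f c w) = c u"
    proof (cases "c u = 0")
      case True
      then have "u \<notin> {x. c x \<noteq> 0}" by simp
      then have "{x. c x \<noteq> 0} \<in> C" "\<not> {v, w} \<subseteq> {x. c x \<noteq> 0}"
        using supp unfolding star by auto
      moreover have "f c = c" using True by (auto simp: f_def)
      moreover have "min (c v) (c w) = 0"
        using nn[of v] nn[of w] \<open>\<not> {v, w} \<subseteq> _\<close> by (auto simp: min_def)
      ultimately show ?thesis using True by simp
    next
      case False
      then have "{x. c x \<noteq> 0} \<notin> C" using uC by blast
      then obtain B where B: "{x. c x \<noteq> 0} = insert u B" "B \<union> {v, w} \<in> C" "\<not> {v, w} \<subseteq> B"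
        using supp unfolding star by blast
      have "u \<notin> B" using uC[OF B(2)] by auto
      have B': "x \<in> B \<longleftrightarrow> c x \<noteq> 0 \<and> x \<noteq> u" for x
        using B(1) \<open>u \<notin> B\<close> by blast
      have "0 < c u" using nn[of u] False by simp
      then have "{x. f c x \<noteq> 0} = B \<union> {v, w}"
        using uvw nn B' by (auto simp: f_def add_nonneg_eq_0_iff split: if_splits)
      moreover have "c v = 0 \<or> c w = 0"
        using B(3) B' uvw by auto
      then have "min (f c v) (f c w) = c u"
        using uvw nn[of v] nn[of w] by (auto simp: f_def min_def)
      ultimately show ?thesis using B(2) by simp
    qed
    then show "f c \<in> coords C"
      using nn by (auto simp: coords_def f_def)
    show "g (f c) = c"
      unfolding g_def[abs_def] using main by (auto simp: f_def uvw uvw[symmetric])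
    define S where "S = {x. c x \<noteq> 0} - {u, v, w}"
    have "finite {x. c x \<noteq> 0}" using uni[OF supp] unimodular_finite by blast
    then have fS: "finite S" by (simp add: S_def)
    have c1: "comb c = (\<Sum>x\<in>insert u (insert v (insert w S)). c x *\<^sub>R rvec x)"
      by (rule comb_eq_sum) (use fS in \<open>auto simp: S_def\<close>)
    have c2: "comb (f c) = (\<Sum>x\<in>insert u (insert v (insert w S)). f c x *\<^sub>R rvec x)"
      by (rule comb_eq_sum) (use fS in \<open>auto simp: S_def f_def\<close>)
    have S: "u \<notin> S" "v \<notin> S" "w \<notin> S" by (auto simp: S_def)
    have "(\<Sum>x\<in>S. f c x *\<^sub>R rvec x) = (\<Sum>x\<in>S. c x *\<^sub>R rvec x)"
      by (intro sum.cong) (auto simp: S_def f_def)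
    then show "comb (f c) = comb c"
      unfolding c1 c2 using S fS uvw vw(2)
      by (simp add: f_def) (simp add: u_def rvec_add algebra_simps)
  qed
  have g_in: "g c \<in> coords (star v w C)" and fg: "f (g c) = c"
    if c: "c \<in> coords C" for c
  proof -
    have nn: "\<And>x. 0 \<le> c x" and supp: "{x. c x \<noteq> 0} \<in> C"
      using c by (auto simp: coords_def)
    have cu: "c u = 0" using uC[OF supp] by simp
    show "f (g c) = c"
      using cu uvw by (auto simp: f_def g_def)
    define m where "m = min (c v) (c w)"
    have m: "0 \<le> m" "m \<le> c v" "m \<le> c w" "m = c v \<or> m = c w"
      using nn by (auto simp: m_def)
    have g: "g c x = (if x = u then m else if x = v \<or> x = w then c x - m else c x)" for x
      by (simp add: g_def m_def)
    have "{x. g c x \<noteq> 0} \<in> star v w C"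
    proof (cases "m = 0")
      case True
      then have "g c = c" using cu by (auto simp: g)
      moreover have "c v = 0 \<or> c w = 0" using m True by auto
      then have "\<not> {v, w} \<subseteq> {x. c x \<noteq> 0}" by auto
      ultimately show ?thesis using supp unfolding star by auto
    next
      case False
      define B where "B = {x. g c x \<noteq> 0} - {u}"
      have "{x. c x \<noteq> 0} = B \<union> {v, w}"
        using m False cu uvw unfolding B_def g by auto
      moreover have "\<not> {v, w} \<subseteq> B"
        using m(4) uvw by (auto simp: B_def g)
      moreover have "{x. g c x \<noteq> 0} = insert u B"
        using False by (auto simp: B_def g)
      ultimately show ?thesis using supp unfolding star by auto
    qed
    then show "g c \<in> coords (star v w C)"
      using nn m by (simp add: coords_def g)
  qed
  have "bij_betw f (coords (star v w C)) (coords C)"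
    by (rule bij_betw_byWitness[where f' = g]) (use f_in gf g_in fg in auto)
  moreover have "bij_betw comb (coords C) {x. \<forall>j. 0 \<le> x $ j}"
    using C by (simp add: regular_fan_def)
  ultimately have "bij_betw (comb \<circ> f) (coords (star v w C)) {x. \<forall>j. 0 \<le> x $ j}"
    by (rule bij_betw_trans)
  then have "bij_betw comb (coords (star v w C)) {x. \<forall>j. 0 \<le> x $ j}"
    by (rule bij_betw_cong[THEN iffD1, rotated]) (simp add: comb_f)
  then show ?thesis
    unfolding regular_fan_def using fin uni down by blast
qed

subsection \<open>Subdividing a fan along hyperplanes\<close>

definition cut_edges :: "int ^ 'k \<Rightarrow> (int ^ 'k) set set \<Rightarrow> ((int ^ 'k) \<times> (int ^ 'k)) set"
  where "cut_edges h C = {(v, w). {v, w} \<in> C \<and> 0 < ipair h v \<and> ipair h w < 0}"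

lemma finite_cut_edges:
  assumes "regular_fan C"
  shows "finite (cut_edges h C)"
proof -
  have "finite (\<Union>C)"
    using assms regular_fan_finite regular_fan_unimodular unimodular_finite by blast
  moreover have "cut_edges h C \<subseteq> \<Union>C \<times> \<Union>C"
    by (auto simp: cut_edges_def)
  ultimately show ?thesis by (meson finite_SigmaI finite_subset)
qed

text \<open>A new edge has \<open>v + w\<close> as an end, and its other end lies in a common cone
  of \<open>C\<close> with both \<open>v\<close> and \<open>w\<close>.\<close>

lemma star_edge:
  assumes C: "regular_fan C" and xy: "{x, y} \<in> star v w C" "x \<noteq> y"
  obtains "{x, y} \<in> C" "\<not> {v, w} \<subseteq> {x, y}"
  | "x = v + w" "{v, y} \<in> C" "{w, y} \<in> C"
  | "y = v + w" "{x, v} \<in> C" "{x, w} \<in> C"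
proof (cases "{x, y} \<in> C \<and> \<not> {v, w} \<subseteq> {x, y}")
  case False
  then obtain B where B: "{x, y} = insert (v + w) B" "B \<union> {v, w} \<in> C"
    using xy unfolding star_def by blast
  then have mem: "v + w \<in> {x, y}" "x \<in> insert (v + w) B" "y \<in> insert (v + w) B"
    by blast+
  show ?thesis
  proof (cases "x = v + w")
    case True
    then have "y \<in> B" using mem xy(2) by auto
    then have "{v, y} \<subseteq> B \<union> {v, w}" "{w, y} \<subseteq> B \<union> {v, w}" by auto
    then show ?thesis using that(2) True regular_fan_subset[OF C B(2)] by blast
  next
    case False
    then have "y = v + w" "x \<in> B" using mem by auto
    moreover from this have "{x, v} \<subseteq> B \<union> {v, w}" "{x, w} \<subseteq> B \<union> {v, w}" by auto
    ultimately show ?thesis using that(3) regular_fan_subset[OF C B(2)] by blast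
  qed
qed (use that(1) in blast)

text \<open>If \<open>g\<close> is positive (negative) at \<open>v + w\<close>, it is so at
  \<open>v\<close> or at \<open>w\<close>, and a cut new edge would yield a cut old one. Hence
  hyperplanes can be treated one after another.\<close>

lemma star_cut_edges_empty:
  assumes C: "regular_fan C" and "cut_edges g C = {}"
  shows "cut_edges g (star v w C) = {}"
proof -
  have no: False if "{x, y} \<in> C" "0 < ipair g x" "ipair g y < 0" for x y
    using assms(2) that by (auto simp: cut_edges_def)
  have False if xy: "{x, y} \<in> star v w C" "0 < ipair g x" "ipair g y < 0" for x y
  proof -
    have "x \<noteq> y" using xy by auto
    with C xy(1) show False
    proof (cases rule: star_edge)
      case 1
      then show False using no xy by blast
    next
      case 2
      then have "0 < ipair g v \<or> 0 < ipair g w" using xy(2) by (auto simp: ipair_add)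
      then show False using no 2 xy by blast
    next
      case 3
      then have "ipair g v < 0 \<or> ipair g w < 0" using xy(3) by (auto simp: ipair_add)
      then show False using no 3 xy by blast
    qed
  qed
  then show ?thesis by (auto simp: cut_edges_def)
qed

text \<open>On a new edge from \<open>v + w\<close> to \<open>y\<close> the variation is that of the
  old cut edge \<open>(v, y)\<close> plus the negative number \<open>ipair h w\<close>, so it drops
  below the maximum; the case of \<open>y = v + w\<close> is symmetric.\<close>

lemma star_cut_edges_decrease:
  assumes C: "regular_fan C" and vw: "(v, w) \<in> cut_edges h C"
    and max: "\<And>x y. (x, y) \<in> cut_edges h C \<Longrightarrow> ipair h x - ipair h y \<le> ipair h v - ipair h w"
    and xy: "(x, y) \<in> cut_edges h (star v w C)"
  shows "(x, y) \<in> cut_edges h C - {(v, w)} \<or> ipair h x - ipair h y < ipair h v - ipair h w"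
proof -
  have h: "0 < ipair h v" "ipair h w < 0" "0 < ipair h x" "ipair h y < 0" "{x, y} \<in> star v w C"
    using vw xy by (auto simp: cut_edges_def)
  have "x \<noteq> y" using h by auto
  with C h(5) show ?thesis
  proof (cases rule: star_edge)
    case 1
    then show ?thesis using h by (auto simp: cut_edges_def)
  next
    case 2
    then have "ipair h v - ipair h y \<le> ipair h v - ipair h w"
      using h by (intro max) (auto simp: cut_edges_def)
    then show ?thesis using 2 h by (simp add: ipair_add)
  next
    case 3
    then have "ipair h x - ipair h w \<le> ipair h v - ipair h w"
      using h by (intro max) (auto simp: cut_edges_def)
    then show ?thesis using 3 h by (simp add: ipair_add)
  qed
qed

text \<open>Starring a cut edge on which \<open>h\<close> has maximal variation only creates cut edges of smaller
  variation, so the multiset of variations decreases.\<close>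

lemma regular_fan_cut:
  assumes "regular_fan C"
  shows "\<exists>C'. regular_fan C' \<and> cut_edges h C' = {} \<and>
    (\<forall>g. cut_edges g C = {} \<longrightarrow> cut_edges g C' = {})"
proof -
  define var where "var = (\<lambda>(x, y). nat (ipair h x - ipair h y))"
  define \<mu> where "\<mu> C = image_mset var (mset_set (cut_edges h C))" for C
  have "wf (inv_image (mult less_than) \<mu>)"
    by (intro wf_inv_image wf_mult wf_less_than)
  then show ?thesis
    using assms
  proof (induction C rule: wf_induct_rule)
    case (less C)
    show ?case
    proof (cases "cut_edges h C = {}")
      case True
      then show ?thesis using less.prems by blast
    next
      case False
      have fin: "finite (cut_edges h C)" using finite_cut_edges less.prems by blast
      then have "Max (var ` cut_edges h C) \<in> var ` cut_edges h C"
        using False by (intro Max_in) auto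
      then obtain e where "e \<in> cut_edges h C" and eq: "Max (var ` cut_edges h C) = var e"
        by blast
      then have e: "e \<in> cut_edges h C" "\<And>e'. e' \<in> cut_edges h C \<Longrightarrow> var e' \<le> var e"
        using fin by (simp_all flip: eq)
      obtain v w where vw: "e = (v, w)" by (cases e)
      have max: "ipair h x - ipair h y \<le> ipair h v - ipair h w" if "(x, y) \<in> cut_edges h C" for x y
        using e(2)[OF that] e(1) that by (auto simp: vw var_def cut_edges_def)
      define C1 where "C1 = star v w C"
      have edge: "{v, w} \<in> C" "v \<noteq> w"
        using e(1) by (auto simp: vw cut_edges_def)
      then have C1: "regular_fan C1"
        unfolding C1_def using regular_fan_star less.prems by blast
      have fin1: "finite (cut_edges h C1)" using finite_cut_edges C1 by blast
      \<comment> \<open>\<open>X\<close> holds the cut edges that survive. Outside \<open>X\<close>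
        the old multiset still has \<open>e\<close>, while the new one has only smaller variations:
        a single step of the multiset order.\<close>
      define X where "X = cut_edges h C1 \<inter> (cut_edges h C - {e})"
      have "\<mu> C1 = image_mset var (mset_set X) + image_mset var (mset_set (cut_edges h C1 - X))"
        unfolding \<mu>_def image_mset_union[symmetric] using fin1
        by (subst mset_set_Union[symmetric]) (auto simp: X_def intro!: arg_cong[where f = mset_set] arg_cong[where f = "image_mset var"])
      moreover have "\<mu> C = image_mset var (mset_set X) + image_mset var (mset_set (cut_edges h C - X))"
        unfolding \<mu>_def image_mset_union[symmetric] using fin
        by (subst mset_set_Union[symmetric]) (auto simp: X_def intro!: arg_cong[where f = mset_set] arg_cong[where f = "image_mset var"])
      moreover have "(image_mset var (mset_set X) + image_mset var (mset_set (cut_edges h C1 - X)),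
          image_mset var (mset_set X) + image_mset var (mset_set (cut_edges h C - X))) \<in> mult less_than"
      proof (rule one_step_implies_mult)
        have eX: "e \<in> cut_edges h C - X" using e(1) by (simp add: X_def)
        then have "e \<in># mset_set (cut_edges h C - X)"
          using fin by simp
        then show "image_mset var (mset_set (cut_edges h C - X)) \<noteq> {#}" by auto
        have "var e' < var e" if "e' \<in> cut_edges h C1 - X" for e'
        proof -
          obtain x y where xy: "e' = (x, y)" by (cases e')
          have "(x, y) \<in> cut_edges h (star v w C)" "(x, y) \<notin> cut_edges h C - {(v, w)}"
            using that by (auto simp: xy X_def C1_def vw)
          then have "ipair h x - ipair h y < ipair h v - ipair h w"
            using star_cut_edges_decrease[OF less.prems _ max] e(1) vw by blast
          then show ?thesis
            using e(1) by (auto simp: var_def xy vw cut_edges_def)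
        qed
        then show "\<forall>k\<in>#image_mset var (mset_set (cut_edges h C1 - X)).
            \<exists>j\<in>#image_mset var (mset_set (cut_edges h C - X)). (k, j) \<in> less_than"
          using eX fin fin1 by auto
      qed
      ultimately have "(C1, C) \<in> inv_image (mult less_than) \<mu>"
        by (simp only: in_inv_image)
      from less.IH[OF this C1] obtain C' where C': "regular_fan C'" "cut_edges h C' = {}"
        "\<And>g. cut_edges g C1 = {} \<Longrightarrow> cut_edges g C' = {}"
        by auto
      show ?thesis
        using C' star_cut_edges_empty[OF less.prems, of _ v w]
        by (intro exI[of _ C']) (simp add: C1_def)
    qed
  qed
qed

text \<open>Generators of one cone strictly on opposite sides of a hyperplane would span a cut edge,
  since fans are closed under subsets.\<close>

lemma regular_fan_adapted:
  fixes H :: "(int ^ 'k) set"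
  assumes "finite H"
  shows "\<exists>C. regular_fan C \<and>
    (\<forall>A\<in>C. \<forall>h\<in>H. (\<forall>v\<in>A. 0 \<le> ipair h v) \<or> (\<forall>v\<in>A. ipair h v \<le> 0))"
proof -
  have "\<exists>C :: (int ^ 'k) set set. regular_fan C \<and> (\<forall>h\<in>H. cut_edges h C = {})"
    using assms
  proof (induction H)
    case empty
    then show ?case using regular_fan_orthant by blast
  next
    case (insert h H)
    then obtain C :: "(int ^ 'k) set set" where C: "regular_fan C" "\<forall>h\<in>H. cut_edges h C = {}"
      by blast
    then show ?case
      using regular_fan_cut[OF C(1), of h] by blast
  qed
  then obtain C :: "(int ^ 'k) set set" where C: "regular_fan C" "\<forall>h\<in>H. cut_edges h C = {}"
    by blast
  have "(\<forall>v\<in>A. 0 \<le> ipair h v) \<or> (\<forall>v\<in>A. ipair h v \<le> 0)" if "A \<in> C" "h \<in> H" for A h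
  proof (rule ccontr)
    assume "\<not> ?thesis"
    then obtain v w where vw: "v \<in> A" "w \<in> A" "ipair h v < 0" "0 < ipair h w"
      unfolding de_Morgan_disj Ball_def not_all not_imp not_le by (elim conjE exE)
    then have "{w, v} \<in> C"
      by (intro regular_fan_subset[OF C(1) that(1)]) simp
    then have "(w, v) \<in> cut_edges h C" using vw by (simp add: cut_edges_def)
    then show False using C(2) that(2) by simp
  qed
  with C(1) show ?thesis by blast
qed

subsection \<open>Integer piecewise affine maps\<close>

text \<open>The lift to height 1, which turns integral affine forms into integral linear
  ones.\<close>

definition hom :: "real ^ 'n \<Rightarrow> real ^ ('n option)"
  where "hom x = (\<chi> k. case k of None \<Rightarrow> 1 | Some i \<Rightarrow> x $ i)"

lemma hom_nth [simp]: "hom x $ None = 1" "hom x $ Some i = x $ i"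
  by (simp_all add: hom_def)

lemma sum_UNIV_option:
  fixes f :: "'n::finite option \<Rightarrow> 'a::comm_monoid_add"
  shows "(\<Sum>k\<in>UNIV. f k) = f None + (\<Sum>i\<in>UNIV. f (Some i))"
  by (simp add: UNIV_option_conv sum.reindex)

lemma inner_hom: "rvec h \<bullet> hom x = of_int (h $ None) + (\<Sum>i\<in>UNIV. of_int (h $ Some i) * x $ i)"
  by (simp add: inner_vec_def sum_UNIV_option)

lemma continuous_on_inner_hom: "continuous_on S (\<lambda>x. rvec h \<bullet> hom x)"
  unfolding inner_hom by (intro continuous_intros)

lemma hom_convex_comb: "u + v = 1 \<Longrightarrow> hom (u *\<^sub>R x + v *\<^sub>R y) = u *\<^sub>R hom x + v *\<^sub>R hom y"
  by (auto simp: vec_eq_iff hom_def split: option.split)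

lemma integer_affine_on_displacement:
  fixes \<eta> :: "real ^ 'n \<Rightarrow> real ^ 'n"
  assumes "integer_affine_on T \<eta>"
  shows "\<exists>h. \<forall>x\<in>T. \<eta> x $ j - x $ j = rvec h \<bullet> hom x"
proof -
  obtain M :: "real ^ 'n ^ 'n" and b :: "real ^ 'n"
    where M: "\<And>i j. M $ i $ j \<in> \<int>" and b: "\<And>i. b $ i \<in> \<int>" and \<eta>: "\<And>x. x \<in> T \<Longrightarrow> \<eta> x = M *v x + b"
    using assms unfolding integer_affine_on_def by blast
  \<comment> \<open>Row \<open>j\<close> of \<open>M\<close> minus the identity, with the
    translation part at \<open>None\<close>. All entries are integers, so the floors only convert
    types.\<close>
  define h :: "int ^ ('n option)" where
    "h = (\<chi> k. case k of None \<Rightarrow> \<lfloor>b $ j\<rfloor> | Some i \<Rightarrow> \<lfloor>M $ j $ i\<rfloor> - (if i = j then 1 else 0))"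
  have "\<eta> x $ j - x $ j = rvec h \<bullet> hom x" if "x \<in> T" for x
  proof -
    have M': "real_of_int \<lfloor>M $ j $ i\<rfloor> = M $ j $ i" for i
      using M[of j i] by (auto elim: Ints_cases)
    have b': "real_of_int \<lfloor>b $ j\<rfloor> = b $ j"
      using b[of j] by (auto elim: Ints_cases)
    have "of_int (h $ Some i) = M $ j $ i - (if i = j then 1 else 0)" for i
      by (simp add: h_def M')
    then have "rvec h \<bullet> hom x = b $ j + (\<Sum>i\<in>UNIV. (M $ j $ i - (if i = j then 1 else 0)) * x $ i)"
      unfolding inner_hom by (simp add: h_def b')
    also have "\<dots> = b $ j + (\<Sum>i\<in>UNIV. M $ j $ i * x $ i) - (\<Sum>i\<in>UNIV. if i = j then x $ i else 0)"
      by (simp add: left_diff_distrib sum_subtractf if_distrib[of "\<lambda>c. c * _"] cong: if_cong)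
    also have "\<dots> = \<eta> x $ j - x $ j"
      using \<eta>[OF that] by (simp add: matrix_vector_mult_def)
    finally show ?thesis by simp
  qed
  then show ?thesis by blast
qed

lemma Z_map_pieces:
  assumes "Z_map P Q \<eta>"
  obtains K where "finite K" "\<Union>K = P" "\<And>T. T \<in> K \<Longrightarrow> integer_affine_on T \<eta>"
    "\<And>T. T \<in> K \<Longrightarrow> closed T"
proof -
  obtain K where K: "triangulates K P" "\<forall>T\<in>K. integer_affine_on T \<eta>"
    using assms unfolding Z_map_def by (elim conjE exE)
  then have "finite K" "\<Union>K = P" "\<forall>S\<in>K. \<exists>n. n simplex S"
    by (simp_all add: triangulates_def simplicial_complex_def)
  then show ?thesis
    using that K(2) closed_simplex by metis
qed

text \<open>One form for each piece and coordinate suffices; these forms are the hyperplanes along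
  which the fan is cut.\<close>

lemma Z_map_displacement:
  fixes \<eta> :: "real ^ 'n \<Rightarrow> real ^ 'n"
  assumes "Z_map P Q \<eta>"
  obtains H where "finite H" "\<And>x j. x \<in> P \<Longrightarrow> \<exists>h\<in>H. \<eta> x $ j - x $ j = rvec h \<bullet> hom x"
proof -
  obtain K where K: "finite K" "\<Union>K = P" "\<And>T. T \<in> K \<Longrightarrow> integer_affine_on T \<eta>"
    using Z_map_pieces[OF assms] by metis
  have "\<exists>h. \<forall>x\<in>T. \<eta> x $ j - x $ j = rvec h \<bullet> hom x" if "T \<in> K" for T j
    using integer_affine_on_displacement[OF K(3)[OF that]] .
  then obtain h where h: "\<And>T j x. T \<in> K \<Longrightarrow> x \<in> T \<Longrightarrow> \<eta> x $ j - x $ j = rvec (h T j) \<bullet> hom x"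
    by metis
  show ?thesis
  proof (rule that)
    show "finite ((\<lambda>(T, j). h T j) ` (K \<times> UNIV))"
      using K(1) by simp
    show "\<exists>h\<in>(\<lambda>(T, j). h T j) ` (K \<times> UNIV). \<eta> x $ j - x $ j = rvec h \<bullet> hom x"
      if "x \<in> P" for x j
    proof -
      have "x \<in> \<Union>K" using K(2) that by simp
      then obtain T where T: "T \<in> K" "x \<in> T" by blast
      show ?thesis
        by (rule bexI[of _ "h T j"]) (use h T in auto)
    qed
  qed
qed

lemma Z_map_continuous_on:
  assumes "Z_map P Q \<eta>"
  shows "continuous_on P \<eta>"
proof -
  obtain K where K: "finite K" "\<Union>K = P" "\<And>T. T \<in> K \<Longrightarrow> integer_affine_on T \<eta>"
      "\<And>T. T \<in> K \<Longrightarrow> closed T"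
    using Z_map_pieces[OF assms] by metis
  have "continuous_on (\<Union>T\<in>K. T) \<eta>"
  proof (rule continuous_on_closed_Union[OF K(1)])
    fix T assume T: "T \<in> K"
    show "closed T" using K(4)[OF T] .
    obtain M :: "real ^ 'a ^ 'b" and b where "\<forall>x\<in>T. \<eta> x = M *v x + b"
      using K(3)[OF T] unfolding integer_affine_on_def by blast
    moreover have "continuous_on T (\<lambda>x. M *v x + b)"
      by (intro continuous_intros linear_continuous_on matrix_vector_mul_bounded_linear)
    ultimately show "continuous_on T \<eta>"
      by (simp cong: continuous_on_cong)
  qed
  then show ?thesis using K(2) by simp
qed

text \<open>On a piece, \<open>q (M x + b) = M (q x) + q b\<close> with integral \<open>M\<close>
  and \<open>b\<close>.\<close>

lemma Z_map_denominator:
  assumes "Z_map P Q \<eta>" "x \<in> P" "\<And>i. real q * x $ i \<in> \<int>"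
  shows "real q * \<eta> x $ j \<in> \<int>"
proof -
  obtain T where T: "x \<in> T" "integer_affine_on T \<eta>"
    using Z_map_pieces[OF assms(1)] assms(2) by (metis UnionE)
  then obtain M :: "real ^ 'a ^ 'b" and b
    where M: "\<And>i j. M $ i $ j \<in> \<int>" "\<And>i. b $ i \<in> \<int>" "\<eta> x = M *v x + b"
    unfolding integer_affine_on_def by blast
  have "real q * \<eta> x $ j = (\<Sum>i\<in>UNIV. M $ j $ i * (real q * x $ i)) + real q * b $ j"
    by (simp add: M(3) matrix_vector_mult_def algebra_simps sum_distrib_left)
  also have "\<dots> \<in> \<int>"
    by (intro Ints_add Ints_sum Ints_mult[OF M(1) assms(3)] Ints_mult[OF Ints_of_nat M(2)])
  finally show ?thesis .
qed

text \<open>On the segment from \<open>x\<close> to \<open>y\<close> every displacement function \<open>h\<close> either vanishes identically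
  or has no zero, so the fixed points form a clopen subset of the segment.\<close>

lemma fixed_point_same_signs:
  fixes \<eta> :: "real ^ 'n \<Rightarrow> real ^ 'n"
  assumes "convex Q" "continuous_on Q \<eta>" "finite H"
    and H: "\<And>x j. x \<in> Q \<Longrightarrow> \<exists>h\<in>H. \<eta> x $ j - x $ j = rvec h \<bullet> hom x"
    and xy: "x \<in> Q" "y \<in> Q" "\<eta> x = x"
    and sgn: "\<And>h. h \<in> H \<Longrightarrow> sgn (rvec h \<bullet> hom y) = sgn (rvec h \<bullet> hom x)"
  shows "\<eta> y = y"
proof -
  let ?S = "closed_segment x y"
  have SQ: "?S \<subseteq> Q"
    using assms(1) xy closed_segment_subset by blast
  have sgnS: "(rvec h \<bullet> hom z = 0) = (rvec h \<bullet> hom x = 0)" if h: "h \<in> H" and z: "z \<in> ?S" for h z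
  proof -
    obtain t where t: "0 \<le> t" "t \<le> 1" "z = (1 - t) *\<^sub>R x + t *\<^sub>R y"
      using z unfolding in_segment by blast
    define p q where "p = rvec h \<bullet> hom x" and "q = rvec h \<bullet> hom y"
    have eq: "rvec h \<bullet> hom z = (1 - t) * p + t * q"
      by (simp add: t(3) hom_convex_comb inner_add_right p_def q_def)
    have s: "sgn q = sgn p" using sgn[OF h] by (simp add: p_def q_def)
    consider "p = 0" "q = 0" | "p > 0" "q > 0" | "p < 0" "q < 0"
      using s by (auto simp: sgn_if split: if_splits)
    then have "((1 - t) * p + t * q = 0) = (p = 0)"
    proof cases
      case 2
      then have "0 < (1 - t) * p + t * q"
        using t by (cases "t = 0") (auto intro: add_nonneg_pos)
      then show ?thesis using 2 by simp
    next
      case 3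
      then have "(1 - t) * p \<le> 0" "t * q \<le> 0" "t = 0 \<or> t * q < 0"
        using t by (auto simp: mult_nonneg_nonpos mult_pos_neg mult_less_0_iff)
      then have "(1 - t) * p + t * q < 0"
        using 3 by auto
      then show ?thesis using 3 by simp
    qed simp
    then show ?thesis using eq by (simp add: p_def)
  qed
  have "\<eta> y $ j - y $ j = 0" for j
  proof -
    define g where "g z = \<eta> z $ j - z $ j" for z
    have g: "continuous_on ?S g"
      unfolding g_def using continuous_on_subset[OF assms(2) SQ] by (intro continuous_intros)
    \<comment> \<open>The forms in \<open>H1\<close> have no zero on the segment. The set
      \<open>W\<close> where the displacement equals one of them is therefore the complement of its
      zero set \<open>Z\<close>, and both are closed.\<close>
    define H1 where "H1 = {h \<in> H. rvec h \<bullet> hom x \<noteq> 0}"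
    define Z where "Z = {z \<in> ?S. g z = 0}"
    define W where "W = (\<Union>h\<in>H1. {z \<in> ?S. g z - rvec h \<bullet> hom z = 0})"
    have "closed Z"
      unfolding Z_def using g by (rule continuous_closed_preimage_constant) simp
    moreover have "closed W"
      unfolding W_def
    proof (rule closed_UN)
      show "finite H1" using assms(3) by (simp add: H1_def)
      show "\<forall>h\<in>H1. closed {z \<in> ?S. g z - rvec h \<bullet> hom z = 0}"
        by (intro ballI continuous_closed_preimage_constant continuous_on_diff[OF g]
            continuous_on_inner_hom) simp
    qed
    moreover have "?S \<subseteq> Z \<union> W"
    proof
      fix z assume z: "z \<in> ?S"
      then obtain h where h: "h \<in> H" "g z = rvec h \<bullet> hom z"
        using H SQ unfolding g_def by blast
      then show "z \<in> Z \<union> W"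
        using z sgnS[OF h(1) z] by (cases "h \<in> H1") (auto simp: Z_def W_def H1_def)
    qed
    moreover have "Z \<inter> W \<inter> ?S = {}"
    proof (rule ccontr)
      assume "Z \<inter> W \<inter> ?S \<noteq> {}"
      then obtain z h where z: "z \<in> ?S" "g z = 0" "h \<in> H1" "g z - rvec h \<bullet> hom z = 0"
        unfolding Z_def W_def by blast
      then have "h \<in> H" "rvec h \<bullet> hom x \<noteq> 0" "rvec h \<bullet> hom z = 0"
        by (simp_all add: H1_def)
      with sgnS[OF \<open>h \<in> H\<close> z(1)] show False by simp
    qed
    moreover have "x \<in> Z"
      using xy(3) by (simp add: Z_def g_def)
    ultimately have "W \<inter> ?S = {}"
      using connected_segment[of x y] unfolding connected_closed by (metis disjoint_iff ends_in_segment(1))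
    then have "y \<in> Z" using \<open>?S \<subseteq> Z \<union> W\<close> ends_in_segment(2)[of y x] by blast
    then show ?thesis by (simp add: Z_def g_def)
  qed
  then show ?thesis by (simp add: vec_eq_iff)
qed

subsection \<open>From fans to triangulations\<close>

text \<open>Central projection to height 1, meaningful for vectors of nonzero height only.\<close>

definition dehom :: "int ^ ('n option) \<Rightarrow> real ^ 'n"
  where "dehom v = (\<chi> i. of_int (v $ Some i) / of_int (v $ None))"

lemma rvec_eq_hom: "v $ None \<noteq> 0 \<Longrightarrow> rvec v = of_int (v $ None) *\<^sub>R hom (dehom v)"
  by (auto simp: vec_eq_iff hom_def dehom_def split: option.split)

text \<open>By linearity the integral dual functionals extract real coefficients as well.\<close>

lemma unimodular_coefficients:
  assumes "unimodular A"
  obtains d where "\<And>a v. v \<in> A \<Longrightarrow> rvec (d v) \<bullet> (\<Sum>w\<in>A. a w *\<^sub>R rvec w) = a v"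
proof -
  obtain d where d: "\<And>v w. v \<in> A \<Longrightarrow> w \<in> A \<Longrightarrow> ipair (d v) w = (if v = w then 1 else 0)"
    using unimodular_dual assms by blast
  have "rvec (d v) \<bullet> (\<Sum>w\<in>A. a w *\<^sub>R rvec w) = a v" if "v \<in> A" for a v
  proof -
    have "rvec (d v) \<bullet> (\<Sum>w\<in>A. a w *\<^sub>R rvec w) = (\<Sum>w\<in>A. if w = v then a w else 0)"
      unfolding inner_sum_right by (intro sum.cong) (auto simp: inner_rvec d that)
    also have "\<dots> = a v"
      using that unimodular_finite[OF assms] by simp
    finally show ?thesis .
  qed
  then show ?thesis using that by blast
qed

text \<open>If \<open>q\<close> clears the denominators, then \<open>q\<close> times the lifted
  point is an integer vector \<open>z\<close> with \<open>v $ None\<close> times \<open>z\<close>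
  equal to \<open>q v\<close>. Applying the functional dual to \<open>v\<close> shows that the
  height divides \<open>q\<close>.\<close>

lemma den_dehom:
  assumes "unimodular A" "v \<in> A" "0 < v $ None"
  shows "den (dehom v) = nat (v $ None)"
  unfolding den_def
proof (rule Least_equality)
  have "real (nat (v $ None)) * dehom v $ i = of_int (v $ Some i)" for i
    using assms(3) by (simp add: dehom_def)
  then show "0 < nat (v $ None) \<and> (\<forall>i. real (nat (v $ None)) * dehom v $ i \<in> \<int>)"
    using assms(3) by simp
next
  fix q :: nat assume q: "0 < q \<and> (\<forall>i. real q * dehom v $ i \<in> \<int>)"
  obtain d where d: "\<And>v w. v \<in> A \<Longrightarrow> w \<in> A \<Longrightarrow> ipair (d v) w = (if v = w then 1 else 0)"
    using unimodular_dual assms(1) by blast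
  define z :: "int ^ ('a option)" where
    "z = (\<chi> k. case k of None \<Rightarrow> int q | Some i \<Rightarrow> \<lfloor>real q * dehom v $ i\<rfloor>)"
  have "rvec z = real q *\<^sub>R hom (dehom v)"
    using q by (auto simp: vec_eq_iff z_def hom_def split: option.split elim: Ints_cases)
  then have "of_int (v $ None) *\<^sub>R rvec z = real q *\<^sub>R rvec v"
    using assms(3) by (simp add: rvec_eq_hom)
  then have "of_int (v $ None) * (rvec (d v) \<bullet> rvec z) = real q * (rvec (d v) \<bullet> rvec v)"
    by (metis inner_scaleR_right)
  then have "real_of_int (v $ None * ipair (d v) z) = real_of_int (int q)"
    using d[OF assms(2) assms(2)] by (simp add: inner_rvec)
  then have "v $ None * ipair (d v) z = int q"
    by (simp only: of_int_eq_iff)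
  then have "v $ None dvd int q" by (metis dvd_triv_left)
  then have "v $ None \<le> int q" using q by (intro zdvd_imp_le) auto
  then show "nat (v $ None) \<le> q" by simp
qed

lemma homogeneous_dehom:
  assumes "unimodular A" "v \<in> A" "0 < v $ None"
  shows "homogeneous (dehom v) = v"
proof -
  have "real (nat (v $ None)) * dehom v $ i = of_int (v $ Some i)" for i
    using assms(3) by (simp add: dehom_def)
  then show ?thesis
    unfolding homogeneous_def den_dehom[OF assms]
    using assms(3) by (auto simp: vec_eq_iff split: option.split)
qed

lemma rational_dehom: "rational_point (dehom v)"
  by (simp add: rational_point_def dehom_def)

lemma hom_sum:
  assumes "sum u A = 1"
  shows "hom (\<Sum>v\<in>A. u v *\<^sub>R f v) = (\<Sum>v\<in>A. u v *\<^sub>R hom (f v))"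
  using assms by (auto simp: vec_eq_iff hom_def split: option.split)

text \<open>The hull is the slice of the cone at height 1. Multiplying each coefficient by the
  height of its generator gives the convex weights, and comparing \<open>None\<close> coordinates
  shows that they sum to 1.\<close>

lemma in_hull_dehom:
  assumes fin: "finite A" and pos: "\<And>v. v \<in> A \<Longrightarrow> 0 < v $ None"
  shows "x \<in> convex hull (dehom ` A) \<longleftrightarrow>
    (\<exists>a. (\<forall>v\<in>A. 0 \<le> a v) \<and> hom x = (\<Sum>v\<in>A. a v *\<^sub>R rvec v))" (is "_ \<longleftrightarrow> ?R x")
proof
  have "convex hull (dehom ` A) \<subseteq> Collect ?R"
  proof (rule hull_minimal)
    show "dehom ` A \<subseteq> Collect ?R"
    proof (intro image_subsetI CollectI)
      fix v assume v: "v \<in> A"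
      let ?a = "\<lambda>w. if w = v then 1 / of_int (v $ None) else (0::real)"
      have "hom (dehom v) = (\<Sum>w\<in>A. ?a w *\<^sub>R rvec w)"
        using v fin pos[OF v] by (subst sum.remove[of _ v]) (auto simp: rvec_eq_hom)
      then show "?R (dehom v)"
        using pos[OF v] by (intro exI[of _ ?a]) auto
    qed
    show "convex (Collect ?R)"
    proof (rule convexI, unfold mem_Collect_eq, elim exE conjE)
      fix x y s t a b
      assume st: "0 \<le> s" "0 \<le> t" "s + t = (1::real)"
        and a: "\<forall>v\<in>A. 0 \<le> a v" "hom x = (\<Sum>v\<in>A. a v *\<^sub>R rvec v)"
        and b: "\<forall>v\<in>A. 0 \<le> b v" "hom y = (\<Sum>v\<in>A. b v *\<^sub>R rvec v)"
      have "hom (s *\<^sub>R x + t *\<^sub>R y) = (\<Sum>v\<in>A. (s * a v + t * b v) *\<^sub>R rvec v)"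
        using st by (simp add: hom_convex_comb a b scaleR_sum_right sum.distrib scaleR_left_distrib)
      then show "?R (s *\<^sub>R x + t *\<^sub>R y)"
        using st a b by (intro exI[of _ "\<lambda>v. s * a v + t * b v"]) auto
    qed
  qed
  then show "x \<in> convex hull (dehom ` A) \<Longrightarrow> ?R x" by blast
next
  assume "?R x"
  then obtain a where a: "\<And>v. v \<in> A \<Longrightarrow> 0 \<le> a v" "hom x = (\<Sum>v\<in>A. a v *\<^sub>R rvec v)" by blast
  define u where "u v = a v * of_int (v $ None)" for v
  have "hom x $ None = sum u A"
    unfolding a(2) by (simp add: u_def)
  then have u: "sum u A = 1" by simp
  have "hom x = (\<Sum>v\<in>A. u v *\<^sub>R hom (dehom v))"
    unfolding a(2) by (intro sum.cong) (use pos in \<open>force simp: u_def rvec_eq_hom\<close>)+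
  also have "\<dots> = hom (\<Sum>v\<in>A. u v *\<^sub>R dehom v)"
    by (rule hom_sum[OF u, symmetric])
  finally have "x = (\<Sum>v\<in>A. u v *\<^sub>R dehom v)"
    by (metis hom_nth(2) vec_eq_iff)
  also have "\<dots> \<in> convex hull (dehom ` A)"
    using fin u by (intro convex_sum) (auto simp: u_def a pos less_imp_le intro: hull_inc)
  finally show "x \<in> convex hull (dehom ` A)" .
qed

lemma in_hull_dehomI:
  assumes "finite A" "\<And>v. v \<in> A \<Longrightarrow> 0 < v $ None"
    and "\<And>v. v \<in> A \<Longrightarrow> 0 < a v" "hom x = (\<Sum>v\<in>A. a v *\<^sub>R rvec v)"
  shows "x \<in> convex hull (dehom ` A)"
  using assms(3,4) by (subst in_hull_dehom[OF assms(1,2)]) (auto intro!: exI[of _ a] less_imp_le)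

text \<open>Discarding zero coefficients yields the positive representation that
  \<open>regular_fan_unique\<close> requires.\<close>

lemma hull_dehom_support:
  assumes fin: "finite A" and pos: "\<And>v. v \<in> A \<Longrightarrow> 0 < v $ None"
    and x: "x \<in> convex hull (dehom ` A)"
  obtains B a where "B \<subseteq> A" "\<And>v. v \<in> B \<Longrightarrow> 0 < a v" "hom x = (\<Sum>v\<in>B. a v *\<^sub>R rvec v)"
proof -
  obtain a where a: "\<And>v. v \<in> A \<Longrightarrow> 0 \<le> a v" "hom x = (\<Sum>v\<in>A. a v *\<^sub>R rvec v)"
    using x in_hull_dehom[OF fin pos] by blast
  show ?thesis
  proof (rule that)
    show "{v \<in> A. a v \<noteq> 0} \<subseteq> A" by blast
    show "0 < a v" if "v \<in> {v \<in> A. a v \<noteq> 0}" for v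
      using a(1)[of v] that by simp
    show "hom x = (\<Sum>v\<in>{v \<in> A. a v \<noteq> 0}. a v *\<^sub>R rvec v)"
      unfolding a(2) using fin by (intro sum.mono_neutral_right) auto
  qed
qed

lemma inj_on_dehom:
  assumes A: "unimodular A" and pos: "\<And>v. v \<in> A \<Longrightarrow> 0 < v $ None"
  shows "inj_on dehom A"
  by (rule inj_onI) (metis homogeneous_dehom A pos)

text \<open>An affine dependency has weights of sum 0, so it lifts to a linear dependency among the
  generators, rescaled by their heights; the dual functionals force it to be trivial.\<close>

lemma affine_independent_dehom:
  assumes A: "unimodular A" and pos: "\<And>v. v \<in> A \<Longrightarrow> 0 < v $ None"
  shows "\<not> affine_dependent (dehom ` A)"
proof
  have fin: "finite A" using A unimodular_finite by blast
  obtain d where d: "\<And>a v. v \<in> A \<Longrightarrow> rvec (d v) \<bullet> (\<Sum>w\<in>A. a w *\<^sub>R rvec w) = a v"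
    using unimodular_coefficients A by blast
  assume "affine_dependent (dehom ` A)"
  then obtain U where U: "sum U (dehom ` A) = 0" "\<exists>p\<in>dehom ` A. U p \<noteq> 0"
      "(\<Sum>p\<in>dehom ` A. U p *\<^sub>R p) = 0"
    using fin by (auto simp: affine_dependent_explicit_finite)
  have s: "(\<Sum>v\<in>A. U (dehom v)) = 0" "(\<Sum>v\<in>A. U (dehom v) *\<^sub>R dehom v) = 0"
    using U(1,3) by (simp_all add: sum.reindex[OF inj_on_dehom[OF A pos]])
  have "(\<Sum>v\<in>A. U (dehom v) *\<^sub>R hom (dehom v)) $ k = 0" for k
  proof (cases k)
    case None
    then show ?thesis using s(1) by simp
  next
    case (Some i)
    then show ?thesis using arg_cong[OF s(2), of "\<lambda>x. x $ i"] by simp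
  qed
  then have "(\<Sum>v\<in>A. U (dehom v) *\<^sub>R hom (dehom v)) = 0" by (simp add: vec_eq_iff)
  moreover have "(\<Sum>v\<in>A. U (dehom v) *\<^sub>R hom (dehom v)) = (\<Sum>v\<in>A. (U (dehom v) / of_int (v $ None)) *\<^sub>R rvec v)"
    by (intro sum.cong) (use pos in \<open>force simp: rvec_eq_hom\<close>)+
  ultimately have z: "(\<Sum>v\<in>A. (U (dehom v) / of_int (v $ None)) *\<^sub>R rvec v) = 0" by simp
  have "U (dehom v) = 0" if "v \<in> A" for v
    using d[OF that, of "\<lambda>v. U (dehom v) / of_int (v $ None)"] pos[OF that] unfolding z by simp
  then show False using U(2) by blast
qed

lemma vertices_hull_dehom:
  assumes "unimodular A" "\<And>v. v \<in> A \<Longrightarrow> 0 < v $ None"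
  shows "vertices (convex hull (dehom ` A)) = dehom ` A"
  using extreme_point_of_convex_hull_affine_independent[OF affine_independent_dehom[OF assms]] by blast

lemma regular_simplex_hull_dehom:
  fixes A :: "(int ^ ('n::finite option)) set"
  assumes A: "unimodular A" and pos: "\<And>v. v \<in> A \<Longrightarrow> 0 < v $ None"
    and "convex hull (dehom ` A) \<subseteq> unit_cube"
  shows "regular_simplex (convex hull (dehom ` A))"
proof -
  have "int (card (dehom ` A)) - 1 simplex convex hull (dehom ` A)"
    using affine_independent_dehom[OF A pos] by (intro simplex_convex_hull) simp
  moreover have "homogeneous ` dehom ` A = A"
    using homogeneous_dehom[OF A _ pos] by (simp add: image_image)
  moreover obtain B where "A \<subseteq> B" "Z_basis B"
    using A unfolding unimodular_def by blast
  moreover have V: "vertices (convex hull (dehom ` A)) = dehom ` A"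
    by (rule vertices_hull_dehom[OF A pos])
  moreover have "\<forall>v\<in>dehom ` A. rational_point v"
    using rational_dehom by blast
  ultimately show ?thesis
    unfolding regular_simplex_def V using assms(3) by metis
qed

text \<open>A point common to two hulls has positive representations on subsets of \<open>A\<close>
  and of \<open>B\<close>. By uniqueness these subsets coincide, so the point lies in the hull of
  the common generators.\<close>

lemma simplicial_complex_hulls_dehom:
  assumes C: "regular_fan C" and D: "D \<subseteq> C" "\<And>A B. A \<in> D \<Longrightarrow> B \<subseteq> A \<Longrightarrow> B \<in> D"
    and pos: "\<And>A v. A \<in> D \<Longrightarrow> v \<in> A \<Longrightarrow> 0 < v $ None"
  shows "simplicial_complex ((\<lambda>A. convex hull (dehom ` A)) ` D)"
proof -
  have uni: "unimodular A" if "A \<in> D" for A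
    using that D(1) regular_fan_unimodular[OF C] by blast
  have fin: "finite A" if "A \<in> D" for A
    using unimodular_finite uni that by blast
  have indep: "\<not> affine_dependent (dehom ` A)" if "A \<in> D" for A
    using that by (intro affine_independent_dehom uni pos)
  note face = face_of_convex_hull_affine_independent[OF indep]
  show ?thesis
    unfolding simplicial_complex_def
  proof (intro conjI ballI allI impI; (elim conjE)?)
    show "finite ((\<lambda>A. convex hull (dehom ` A)) ` D)"
      using D(1) regular_fan_finite[OF C] finite_subset by blast
  next
    fix S assume "S \<in> (\<lambda>A. convex hull (dehom ` A)) ` D"
    then obtain A where A: "A \<in> D" "S = convex hull (dehom ` A)" by blast
    have "int (card (dehom ` A)) - 1 simplex S"
      unfolding A(2) using indep[OF A(1)] by (intro simplex_convex_hull) simp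
    then show "\<exists>n. n simplex S" by blast
  next
    fix F S assume "S \<in> (\<lambda>A. convex hull (dehom ` A)) ` D" "F face_of S"
    then obtain A where A: "A \<in> D" "F face_of (convex hull (dehom ` A))" by blast
    then obtain c where c: "c \<subseteq> dehom ` A" "F = convex hull c"
      using face[OF A(1)] by blast
    then obtain B where "B \<subseteq> A" "c = dehom ` B"
      by (auto simp: subset_image_iff)
    then show "F \<in> (\<lambda>A. convex hull (dehom ` A)) ` D"
      using D(2)[OF A(1)] c(2) by blast
  next
    fix S S' assume "S \<in> (\<lambda>A. convex hull (dehom ` A)) ` D" "S' \<in> (\<lambda>A. convex hull (dehom ` A)) ` D"
    then obtain A B where A: "A \<in> D" "S = convex hull (dehom ` A)"
      and B: "B \<in> D" "S' = convex hull (dehom ` B)" by blast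
    have "S \<inter> S' = convex hull (dehom ` (A \<inter> B))"
    proof
      show "convex hull (dehom ` (A \<inter> B)) \<subseteq> S \<inter> S'"
        unfolding A(2) B(2) by (intro Int_greatest hull_mono image_mono) auto
      show "S \<inter> S' \<subseteq> convex hull (dehom ` (A \<inter> B))"
      proof
        fix x assume "x \<in> S \<inter> S'"
        then have xAB: "x \<in> convex hull (dehom ` A)" "x \<in> convex hull (dehom ` B)"
          by (simp_all add: A(2) B(2))
        obtain A' a where a: "A' \<subseteq> A" "\<And>v. v \<in> A' \<Longrightarrow> 0 < a v" "hom x = (\<Sum>v\<in>A'. a v *\<^sub>R rvec v)"
          by (rule hull_dehom_support[OF fin[OF A(1)] pos[OF A(1)] xAB(1)]) (assumption, rule that)
        obtain B' b where b: "B' \<subseteq> B" "\<And>v. v \<in> B' \<Longrightarrow> 0 < b v" "hom x = (\<Sum>v\<in>B'. b v *\<^sub>R rvec v)"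
          by (rule hull_dehom_support[OF fin[OF B(1)] pos[OF B(1)] xAB(2)]) (assumption, rule that)
        have in': "A' \<in> D" "B' \<in> D"
          using D(2)[OF A(1) a(1)] D(2)[OF B(1) b(1)] .
        have "A' = B'"
          by (rule regular_fan_unique[OF C _ _ a(2) b(2)]) (use in' D(1) a(3) b(3) in auto)
        then have "A' \<subseteq> A \<inter> B" using a(1) b(1) by blast
        moreover have "x \<in> convex hull (dehom ` A')"
          using fin[OF in'(1)] pos[OF in'(1)] a(2,3) by (rule in_hull_dehomI)
        ultimately show "x \<in> convex hull (dehom ` (A \<inter> B))"
          by (rule subsetD[OF hull_mono[OF image_mono]])
      qed
    qed
    moreover have "convex hull (dehom ` (A \<inter> B)) face_of S"
      unfolding A(2) face[OF A(1)]
      by (intro exI[of _ "dehom ` (A \<inter> B)"] conjI image_mono Int_lower1 refl)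
    ultimately show "(S \<inter> S') face_of S"
      by (simp only:)
  qed
qed

subsection \<open>Retracts of the cube\<close>

lemma mem_unit_cube: "x \<in> unit_cube \<longleftrightarrow> (\<forall>i. 0 \<le> x $ i \<and> x $ i \<le> 1)"
  by (simp add: mem_box_cart)

text \<open>Every coordinate of \<open>v\<close> is 0 or 1, an end of the unit interval, so it is a
  proper convex combination only of two equal coordinates.\<close>

lemma integer_point_vertex:
  assumes "v \<in> unit_cube" "\<And>i. v $ i \<in> \<int>"
  shows "v \<in> vertices unit_cube"
proof -
  have False if ab: "a \<in> unit_cube" "b \<in> unit_cube" "v \<in> open_segment a b" for a b :: "real ^ 'a"
  proof -
    obtain t where t: "a \<noteq> b" "0 < t" "t < 1" "v = (1 - t) *\<^sub>R a + t *\<^sub>R b"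
      using ab(3) unfolding in_segment by blast
    have "a $ i = b $ i" for i
    proof -
      have v: "v $ i = (1 - t) * a $ i + t * b $ i" by (simp add: t)
      have i: "0 \<le> a $ i" "a $ i \<le> 1" "0 \<le> b $ i" "b $ i \<le> 1" "0 \<le> v $ i" "v $ i \<le> 1"
        using ab assms(1) by (auto simp: mem_unit_cube)
      obtain n where "v $ i = of_int n" using assms(2)[of i] by (auto elim: Ints_cases)
      then consider "v $ i = 0" | "v $ i = 1" using i(5,6) by fastforce
      then show ?thesis
      proof cases
        case 1
        then show ?thesis
          using v t i by (simp add: add_nonneg_eq_0_iff)
      next
        case 2
        then have "(1 - t) * (1 - a $ i) + t * (1 - b $ i) = 0"
          using v by (simp add: algebra_simps)
        then show ?thesis
          using t i by (simp add: add_nonneg_eq_0_iff)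
      qed
    qed
    then show False using t(1) by (simp add: vec_eq_iff)
  qed
  then show ?thesis
    using assms(1) unfolding extreme_point_of_def by blast
qed

section \<open>Cones adapted to the displacement forms and the cube\<close>

lemma sgn_positive_comb:
  fixes a k :: "'a \<Rightarrow> real"
  assumes "finite A" "\<And>v. v \<in> A \<Longrightarrow> 0 < a v" "\<And>v. v \<in> A \<Longrightarrow> 0 \<le> k v"
  shows "sgn (\<Sum>v\<in>A. a v * k v) = (if \<forall>v\<in>A. k v = 0 then 0 else 1)"
proof (cases "\<forall>v\<in>A. k v = 0")
  case False
  then obtain v where v: "v \<in> A" "k v \<noteq> 0" by blast
  have "0 < (\<Sum>v\<in>A. a v * k v)"
    using assms(1) v(1)
  proof (rule sum_pos2)
    show "0 < a v * k v" using assms(2,3)[OF v(1)] v(2) by simp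
    show "0 \<le> a i * k i" if "i \<in> A" for i
      using assms(2,3)[OF that] by simp
  qed
  then show ?thesis using False by simp
qed simp

lemma inner_rvec_comb:
  "rvec h \<bullet> (\<Sum>v\<in>A. a v *\<^sub>R rvec v) = (\<Sum>v\<in>A. a v * of_int (ipair h v))"
  by (simp add: inner_sum_right inner_rvec)

text \<open>With all generators on one side, the sign depends only on whether every pairing
  vanishes, not on the positive coefficients.\<close>

lemma sgn_inner_same_cone:
  assumes "finite A" "(\<forall>v\<in>A. 0 \<le> ipair h v) \<or> (\<forall>v\<in>A. ipair h v \<le> 0)"
    and "\<And>v. v \<in> A \<Longrightarrow> 0 < a v" "\<And>v. v \<in> A \<Longrightarrow> 0 < b v"
  shows "sgn (rvec h \<bullet> (\<Sum>v\<in>A. a v *\<^sub>R rvec v)) = sgn (rvec h \<bullet> (\<Sum>v\<in>A. b v *\<^sub>R rvec v))"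
  using assms(2)
proof
  assume "\<forall>v\<in>A. 0 \<le> ipair h v"
  then show ?thesis
    unfolding inner_rvec_comb using assms by (simp add: sgn_positive_comb)
next
  assume "\<forall>v\<in>A. ipair h v \<le> 0"
  then have "sgn (\<Sum>v\<in>A. a v * - of_int (ipair h v)) = sgn (\<Sum>v\<in>A. b v * - of_int (ipair h v))"
    using assms by (subst (1 2) sgn_positive_comb) auto
  then show ?thesis
    unfolding inner_rvec_comb by (simp add: sum_negf sgn_minus)
qed

text \<open>The homogenized form \<open>1 - x $ i\<close>. Cutting along it separates the cone over
  the cube from the rest of the orthant; the faces \<open>x $ i = 0\<close> already bound the
  orthant.\<close>

definition face_form :: "'n::finite \<Rightarrow> int ^ ('n option)"
  where "face_form i = (\<chi> k. case k of None \<Rightarrow> 1 | Some j \<Rightarrow> if j = i then -1 else 0)"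

lemma ipair_face_form: "ipair (face_form i) v = v $ None - v $ Some i"
proof -
  have "ipair (face_form i) v = v $ None + (\<Sum>j\<in>UNIV. if j = i then - v $ Some j else 0)"
    unfolding ipair_def sum_UNIV_option
    by (simp add: face_form_def if_distrib[of "\<lambda>c. c * _"] cong: if_cong)
  then show ?thesis by simp
qed

lemma inner_face_form: "rvec (face_form i) \<bullet> hom x = 1 - x $ i"
proof -
  have "rvec (face_form i) \<bullet> hom x = 1 + (\<Sum>j\<in>UNIV. if j = i then - x $ j else 0)"
    unfolding inner_hom
    by (simp add: face_form_def if_distrib[of of_int] if_distrib[of "\<lambda>c. c * _"] cong: if_cong)
  then show ?thesis by simp
qed

text \<open>Each face form is nonnegative at \<open>x\<close>, a positive combination of generators
  lying on one side, hence nonnegative at every generator. A generator of height 0 would then have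
  all coordinates 0.\<close>

lemma cube_cone_vertices:
  fixes C :: "(int ^ ('n::finite option)) set set"
  assumes C: "regular_fan C" "A \<in> C"
    and adapted: "\<And>i. (\<forall>v\<in>A. 0 \<le> ipair (face_form i) v) \<or> (\<forall>v\<in>A. ipair (face_form i) v \<le> 0)"
    and x: "x \<in> unit_cube" "\<And>v. v \<in> A \<Longrightarrow> 0 < a v" "hom x = (\<Sum>v\<in>A. a v *\<^sub>R rvec v)"
    and v: "v \<in> A"
  shows "0 < v $ None" "dehom v \<in> unit_cube"
proof -
  have A: "unimodular A" "finite A"
    using regular_fan_unimodular[OF C] unimodular_finite by blast+
  have le: "v $ Some i \<le> v $ None" for i
  proof -
    have "0 \<le> ipair (face_form i) v"
      using adapted[of i]
    proof
      assume neg: "\<forall>v\<in>A. ipair (face_form i) v \<le> 0"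
      have "sgn (\<Sum>v\<in>A. a v * - of_int (ipair (face_form i) v)) =
          (if \<forall>v\<in>A. - real_of_int (ipair (face_form i) v) = 0 then 0 else 1)"
        using A(2) x(2) neg by (intro sgn_positive_comb) auto
      moreover have "(\<Sum>v\<in>A. a v * - of_int (ipair (face_form i) v)) = - (1 - x $ i)"
        unfolding inner_face_form[symmetric] x(3) inner_rvec_comb by (simp add: sum_negf)
      moreover have "x $ i \<le> 1" using x(1) by (simp add: mem_unit_cube)
      ultimately have "\<forall>v\<in>A. - real_of_int (ipair (face_form i) v) = 0"
        by (auto simp: sgn_if split: if_splits)
      then show ?thesis using v by simp
    qed (use v in blast)
    then show ?thesis by (simp add: ipair_face_form)
  qed
  have nn: "0 \<le> v $ k" for k
    using regular_fan_nonneg[OF C v] .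
  show pos: "0 < v $ None"
  proof (rule ccontr)
    assume "\<not> 0 < v $ None"
    then have "v $ None = 0" using nn[of None] by simp
    then have "v $ k = 0" for k
      using le nn[of k] by (cases k) (auto intro: antisym)
    then show False using unimodular_nonzero[OF A(1) v] by (simp add: vec_eq_iff)
  qed
  show "dehom v \<in> unit_cube"
    using pos nn le by (simp add: mem_unit_cube dehom_def)
qed

text \<open>Moving any point of the hull slightly towards \<open>x\<close> makes all coefficients
  positive, so it is a limit of fixed points.\<close>

lemma fixed_hull_dehom:
  fixes A :: "(int ^ ('n::finite option)) set"
  assumes "finite A" and closed: "closed {y \<in> Q. \<sigma> y = y}" and "convex Q" "dehom ` A \<subseteq> Q"
    and pos: "\<And>v. v \<in> A \<Longrightarrow> 0 < v $ None"
    and x: "x \<in> Q" "\<And>v. v \<in> A \<Longrightarrow> 0 < a v" "hom x = (\<Sum>v\<in>A. a v *\<^sub>R rvec v)"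
    and fixed: "\<And>y b. y \<in> Q \<Longrightarrow> (\<And>v. v \<in> A \<Longrightarrow> 0 < b v) \<Longrightarrow> hom y = (\<Sum>v\<in>A. b v *\<^sub>R rvec v) \<Longrightarrow> \<sigma> y = y"
  shows "convex hull (dehom ` A) \<subseteq> {y \<in> Q. \<sigma> y = y}"
proof
  fix y assume y: "y \<in> convex hull (dehom ` A)"
  then have yQ: "y \<in> Q" using assms(3,4) hull_minimal by blast
  obtain b where b: "\<And>v. v \<in> A \<Longrightarrow> 0 \<le> b v" "hom y = (\<Sum>v\<in>A. b v *\<^sub>R rvec v)"
    using y in_hull_dehom[OF assms(1) pos] by blast
  define f where "f n = (1 - inverse (real (Suc n))) *\<^sub>R y + inverse (real (Suc n)) *\<^sub>R x" for n
  have "f n \<in> {y \<in> Q. \<sigma> y = y}" for n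
  proof -
    define t where "t = inverse (real (Suc n))"
    have t: "0 < t" "t \<le> 1" by (simp_all add: t_def inverse_le_1_iff)
    have f: "f n = (1 - t) *\<^sub>R y + t *\<^sub>R x" by (simp add: f_def t_def)
    have fQ: "f n \<in> Q" unfolding f using assms(3) yQ x(1) t by (simp add: convex_def)
    have hom_f: "hom (f n) = (\<Sum>v\<in>A. ((1 - t) * b v + t * a v) *\<^sub>R rvec v)"
      unfolding f by (simp add: hom_convex_comb b x(3) scaleR_sum_right sum.distrib scaleR_left_distrib)
    have "0 < (1 - t) * b v + t * a v" if "v \<in> A" for v
      using b(1)[OF that] x(2)[OF that] t by (intro add_nonneg_pos) auto
    then have "\<sigma> (f n) = f n" using fixed[OF fQ _ hom_f] by simp
    then show ?thesis using fQ by simp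
  qed
  moreover have "f \<longlonglongrightarrow> (1 - 0) *\<^sub>R y + 0 *\<^sub>R x"
    unfolding f_def by (intro tendsto_intros LIMSEQ_inverse_real_of_nat)
  then have "f \<longlonglongrightarrow> y" by simp
  ultimately show "y \<in> {y \<in> Q. \<sigma> y = y}"
    by (rule closed_sequentially[OF closed])
qed

text \<open>Displacement forms have constant sign on each relatively open cone of an adapted fan. So
  one fixed point inside a cone makes its whole open slice fixed, and by closedness the entire
  simplex.\<close>

lemma Z_retract_fan:
  fixes \<sigma> :: "real ^ 'n \<Rightarrow> real ^ 'n"
  assumes \<sigma>: "Z_map unit_cube unit_cube \<sigma>" and P: "P = {x \<in> unit_cube. \<sigma> x = x}"
  obtains C D where "regular_fan C" "D \<subseteq> C" "\<And>A B. A \<in> D \<Longrightarrow> B \<subseteq> A \<Longrightarrow> B \<in> D"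
    "\<And>A v. A \<in> D \<Longrightarrow> v \<in> A \<Longrightarrow> 0 < v $ None" "(\<Union>A\<in>D. convex hull (dehom ` A)) = P"
proof -
  obtain H where H: "finite H" "\<And>x j. x \<in> unit_cube \<Longrightarrow> \<exists>h\<in>H. \<sigma> x $ j - x $ j = rvec h \<bullet> hom x"
    using Z_map_displacement[OF \<sigma>] by metis
  have cont: "continuous_on unit_cube \<sigma>"
    using \<sigma> by (rule Z_map_continuous_on)
  have closedP: "closed {x \<in> unit_cube. \<sigma> x = x}"
  proof -
    have "closed {x \<in> unit_cube. \<sigma> x - x = 0}"
      by (intro continuous_closed_preimage_constant continuous_intros cont closed_cbox)
    then show ?thesis by simp
  qed
  have "finite (H \<union> range face_form)" using H(1) by simp
  then obtain C :: "(int ^ ('n option)) set set" where C: "regular_fan C"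
    and adapted: "\<forall>A\<in>C. \<forall>h\<in>H \<union> range face_form. (\<forall>v\<in>A. 0 \<le> ipair h v) \<or> (\<forall>v\<in>A. ipair h v \<le> 0)"
    using regular_fan_adapted by metis
  define D where "D = {A \<in> C. (\<forall>v\<in>A. 0 < v $ None) \<and> convex hull (dehom ` A) \<subseteq> P}"
  show ?thesis
  proof (rule that)
    show "regular_fan C" by (rule C)
    show "D \<subseteq> C" by (auto simp: D_def)
    show "0 < v $ None" if "A \<in> D" "v \<in> A" for A v
      using that by (simp add: D_def)
    show "B \<in> D" if "A \<in> D" "B \<subseteq> A" for A B
    proof -
      have "convex hull (dehom ` B) \<subseteq> convex hull (dehom ` A)"
        using that(2) by (intro hull_mono image_mono)
      then show ?thesis
        using that regular_fan_subset[OF C, of A B] unfolding D_def by auto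
    qed
    show "(\<Union>A\<in>D. convex hull (dehom ` A)) = P"
    proof
      show "(\<Union>A\<in>D. convex hull (dehom ` A)) \<subseteq> P" by (auto simp: D_def)
      show "P \<subseteq> (\<Union>A\<in>D. convex hull (dehom ` A))"
      proof
        fix x assume "x \<in> P"
        then have x: "x \<in> unit_cube" "\<sigma> x = x" by (simp_all add: P)
        have "0 \<le> hom x $ k" for k
          using x(1) by (cases k) (simp_all add: mem_unit_cube)
        then obtain A a where A: "A \<in> C" and a: "\<And>v. v \<in> A \<Longrightarrow> 0 < a v" "hom x = (\<Sum>v\<in>A. a v *\<^sub>R rvec v)"
          using regular_fan_cover[OF C] by metis
        have fin: "finite A" using regular_fan_unimodular[OF C A] unimodular_finite by blast
        have vert: "0 < v $ None" "dehom v \<in> unit_cube" if "v \<in> A" for v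
          using cube_cone_vertices[OF C A _ x(1) a that] adapted A by blast+
        have "convex hull (dehom ` A) \<subseteq> {y \<in> unit_cube. \<sigma> y = y}"
        proof (rule fixed_hull_dehom[OF fin closedP _ _ vert(1) x(1) a])
          show "convex (unit_cube :: (real ^ 'n) set)" by (rule convex_box)
          show "dehom ` A \<subseteq> unit_cube" using vert(2) by blast
          fix y b assume y: "y \<in> unit_cube" and b: "\<And>v. v \<in> A \<Longrightarrow> 0 < b v" "hom y = (\<Sum>v\<in>A. b v *\<^sub>R rvec v)"
          show "\<sigma> y = y"
          proof (rule fixed_point_same_signs[OF _ cont H(1) H(2) x(1) y x(2)])
            fix h assume "h \<in> H"
            then show "sgn (rvec h \<bullet> hom y) = sgn (rvec h \<bullet> hom x)"
              unfolding a(2) b(2) using adapted A a(1) b(1)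
              by (intro sgn_inner_same_cone[OF fin]) auto
          qed (rule convex_box)
        qed auto
        then have "A \<in> D" using A vert(1) by (simp add: D_def P)
        moreover have "x \<in> convex hull (dehom ` A)"
          using fin vert(1) a by (rule in_hull_dehomI)
        ultimately show "x \<in> (\<Union>A\<in>D. convex hull (dehom ` A))" by blast
      qed
    qed
  qed
qed

section \<open>Common divisors of the vertex denominators\<close>

text \<open>The integer vector \<open>q\<close> times \<open>hom z\<close> has integer coefficients
  on \<open>A\<close> by duality. Its height then expresses \<open>q\<close> as an integral
  combination of the heights of the generators.\<close>

lemma Gcd_heights_dvd:
  assumes A: "unimodular A" and pos: "\<And>v. v \<in> A \<Longrightarrow> 0 < v $ None"
    and z: "z \<in> convex hull (dehom ` A)" "\<And>i. real q * z $ i \<in> \<int>"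
  shows "Gcd ((\<lambda>v. nat (v $ None)) ` A) dvd q"
proof -
  have fin: "finite A" using A unimodular_finite by blast
  obtain b where b: "hom z = (\<Sum>v\<in>A. b v *\<^sub>R rvec v)"
    using z(1) in_hull_dehom[OF fin pos] by blast
  obtain d where d: "\<And>a v. v \<in> A \<Longrightarrow> rvec (d v) \<bullet> (\<Sum>w\<in>A. a w *\<^sub>R rvec w) = a v"
    using unimodular_coefficients A by blast
  define w :: "int ^ ('a option)" where
    "w = (\<chi> k. case k of None \<Rightarrow> int q | Some i \<Rightarrow> \<lfloor>real q * z $ i\<rfloor>)"
  have w: "rvec w = real q *\<^sub>R hom z"
    using z(2) by (auto simp: vec_eq_iff w_def hom_def split: option.split elim: Ints_cases)
  also have "\<dots> = (\<Sum>v\<in>A. (real q * b v) *\<^sub>R rvec v)"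
    by (simp add: b scaleR_sum_right)
  finally have w_sum: "rvec w = (\<Sum>v\<in>A. (real q * b v) *\<^sub>R rvec v)" .
  have c: "real q * b v = of_int (ipair (d v) w)" if "v \<in> A" for v
    using d[OF that, of "\<lambda>v. real q * b v"] by (simp add: w_sum[symmetric] inner_rvec)
  have "real_of_int (w $ None) = (\<Sum>v\<in>A. (real q * b v) * of_int (v $ None))"
    using arg_cong[OF w_sum, of "\<lambda>x. x $ None"] by simp
  also have "\<dots> = real_of_int (\<Sum>v\<in>A. ipair (d v) w * v $ None)"
    using c by simp
  finally have "w $ None = (\<Sum>v\<in>A. ipair (d v) w * v $ None)"
    by (simp only: of_int_eq_iff)
  then have q: "int q = (\<Sum>v\<in>A. ipair (d v) w * v $ None)" by (simp add: w_def)
  have "int (Gcd ((\<lambda>v. nat (v $ None)) ` A)) dvd v $ None" if "v \<in> A" for v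
  proof -
    have "Gcd ((\<lambda>v. nat (v $ None)) ` A) dvd nat (v $ None)"
      using that by (intro Gcd_dvd) auto
    then have "int (Gcd ((\<lambda>v. nat (v $ None)) ` A)) dvd int (nat (v $ None))"
      by (simp only: int_dvd_int_iff)
    then show ?thesis using pos[OF that] by simp
  qed
  then have "int (Gcd ((\<lambda>v. nat (v $ None)) ` A)) dvd int q"
    unfolding q by (intro dvd_sum dvd_mult)
  then show ?thesis by (simp only: int_dvd_int_iff)
qed

text \<open>Rounding \<open>q x\<close> down in each coordinate moves every coordinate by at most
  \<open>1 / q\<close> and does not leave the cube.\<close>

lemma rational_approximation:
  fixes x :: "real ^ 'n"
  assumes "x \<in> unit_cube" "0 < q"
  obtains y where "y \<in> unit_cube" "\<And>i. real q * y $ i \<in> \<int>" "dist y x \<le> real CARD('n) / real q"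
proof -
  define y where "y = (\<chi> i. of_int \<lfloor>real q * x $ i\<rfloor> / real q)"
  have le: "y $ i \<le> x $ i" "x $ i - y $ i \<le> 1 / real q" for i
  proof -
    have "of_int \<lfloor>real q * x $ i\<rfloor> \<le> real q * x $ i" "real q * x $ i \<le> of_int \<lfloor>real q * x $ i\<rfloor> + 1"
      by linarith+
    then have "of_int \<lfloor>real q * x $ i\<rfloor> / real q \<le> x $ i" "x $ i \<le> (of_int \<lfloor>real q * x $ i\<rfloor> + 1) / real q"
      using assms(2) by (simp_all add: pos_divide_le_eq pos_le_divide_eq mult.commute)
    then show "y $ i \<le> x $ i" "x $ i - y $ i \<le> 1 / real q"
      by (simp_all add: y_def add_divide_distrib)
  qed
  show ?thesis
  proof (rule that)
    have "0 \<le> y $ i" for i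
      using assms by (simp add: y_def mem_unit_cube)
    then show "y \<in> unit_cube"
      using le(1) assms(1) unfolding mem_unit_cube by (meson order_trans)
    show "real q * y $ i \<in> \<int>" for i
      using assms(2) by (simp add: y_def)
    have "dist y x \<le> (\<Sum>i\<in>UNIV. \<bar>(y - x) $ i\<bar>)"
      unfolding dist_norm by (rule norm_le_l1_cart)
    also have "\<dots> \<le> (\<Sum>i\<in>(UNIV :: 'n set). 1 / real q)"
      using le by (intro sum_mono) (simp add: abs_of_nonpos)
    also have "\<dots> = real CARD('n) / real q" by simp
    finally show "dist y x \<le> real CARD('n) / real q" .
  qed
qed

text \<open>Near a point \<open>x\<close> with positive coordinates on a maximal cone \<open>A\<close> the retract consists of the
  simplex of \<open>A\<close> alone. For every large \<open>q\<close> the map \<open>\<sigma>\<close> sends a point of \<open>(1/q)\<int>\<^sup>n\<close> near \<open>x\<close> to a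
  point of \<open>(1/q)\<int>\<^sup>n\<close> in this simplex, which forces the greatest common divisor to divide \<open>q\<close>.\<close>

lemma Gcd_heights_maximal:
  fixes \<sigma> :: "real ^ 'n \<Rightarrow> real ^ 'n"
  assumes \<sigma>: "Z_map unit_cube unit_cube \<sigma>" and P: "P = {x \<in> unit_cube. \<sigma> x = x}"
    and image: "\<sigma> ` unit_cube \<subseteq> P"
    and C: "regular_fan C" and D: "D \<subseteq> C" "\<And>A B. A \<in> D \<Longrightarrow> B \<subseteq> A \<Longrightarrow> B \<in> D"
    and pos: "\<And>A v. A \<in> D \<Longrightarrow> v \<in> A \<Longrightarrow> 0 < v $ None"
    and union: "(\<Union>A\<in>D. convex hull (dehom ` A)) = P"
    and A: "A \<in> D" "A \<noteq> {}"
    and max: "\<And>B. B \<in> D \<Longrightarrow> A \<subseteq> B \<Longrightarrow> B = A"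
  shows "Gcd ((\<lambda>v. nat (v $ None)) ` A) = 1"
proof -
  have uni: "unimodular B" if "B \<in> D" for B
    using that D(1) regular_fan_unimodular[OF C] by blast
  have fin: "finite B" if "B \<in> D" for B
    using unimodular_finite uni that by blast
  \<comment> \<open>Dividing the sum of the generators by its height \<open>s\<close> gives the lift
    of a point \<open>x\<close> with all coefficients \<open>1 / s\<close>. Being interior to a
    maximal cone, it avoids every other simplex.\<close>
  define s where "s = (\<Sum>v\<in>A. real_of_int (v $ None))"
  have s: "0 < s"
    unfolding s_def using fin[OF A(1)] A(2) pos[OF A(1)] by (intro sum_pos) auto
  define x :: "real ^ 'n" where "x = (\<chi> i. (\<Sum>v\<in>A. of_int (v $ Some i)) / s)"
  have "hom x $ k = (\<Sum>v\<in>A. (1 / s) *\<^sub>R rvec v) $ k" for k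
    using s by (cases k) (simp_all add: x_def s_def sum_divide_distrib[symmetric])
  then have x: "hom x = (\<Sum>v\<in>A. (1 / s) *\<^sub>R rvec v)" by (simp add: vec_eq_iff)
  have "x \<in> convex hull (dehom ` A)"
    using fin[OF A(1)] pos[OF A(1)] _ x by (rule in_hull_dehomI) (use s in simp_all)
  then have "x \<in> P" using union A(1) by blast
  then have xQ: "x \<in> unit_cube" and \<sigma>x: "\<sigma> x = x" by (simp_all add: P)
  have notin: "x \<notin> convex hull (dehom ` B)" if B: "B \<in> D" "B \<noteq> A" for B
  proof
    assume xB: "x \<in> convex hull (dehom ` B)"
    obtain B' b where b: "B' \<subseteq> B" "\<And>v. v \<in> B' \<Longrightarrow> 0 < b v" "hom x = (\<Sum>v\<in>B'. b v *\<^sub>R rvec v)"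
      by (rule hull_dehom_support[OF fin[OF B(1)] pos[OF B(1)] xB]) (assumption, rule that)
    have "A = B'"
      by (rule regular_fan_unique[OF C _ _ _ b(2), where a = "\<lambda>_. 1 / s"])
        (use A(1) B(1) D b x s in auto)
    then show False using max[OF B(1)] b(1) B(2) by blast
  qed
  define N where "N = (\<Union>B\<in>D - {A}. convex hull (dehom ` B))"
  have "closed N"
    unfolding N_def
  proof (rule closed_UN)
    show "finite (D - {A})" using D(1) regular_fan_finite[OF C] finite_subset by blast
    show "\<forall>B\<in>D - {A}. closed (convex hull (dehom ` B))"
      using fin by (auto intro!: compact_imp_closed finite_imp_compact_convex_hull)
  qed
  moreover have "x \<notin> N" using notin by (auto simp: N_def)
  ultimately obtain \<epsilon> where \<epsilon>: "0 < \<epsilon>" "ball x \<epsilon> \<subseteq> - N"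
    by (metis ComplI open_Compl open_contains_ball)
  obtain \<delta> where \<delta>: "0 < \<delta>" "\<And>y. y \<in> unit_cube \<Longrightarrow> dist y x < \<delta> \<Longrightarrow> dist (\<sigma> y) (\<sigma> x) < \<epsilon>"
    using Z_map_continuous_on[OF \<sigma>] xQ \<epsilon>(1) unfolding continuous_on_iff by metis
  have dvd: "Gcd ((\<lambda>v. nat (v $ None)) ` A) dvd q" if q: "real CARD('n) / \<delta> < real q" for q
  proof -
    have "0 < real CARD('n) / \<delta>" using \<delta>(1) by simp
    then have q0: "0 < real q" using q by linarith
    then obtain y where y: "y \<in> unit_cube" "\<And>i. real q * y $ i \<in> \<int>" "dist y x \<le> real CARD('n) / real q"
      using rational_approximation[OF xQ, of q] by auto
    have "real CARD('n) / real q < \<delta>"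
      using q q0 \<delta>(1) by (simp add: field_simps)
    then have "dist (\<sigma> y) x < \<epsilon>"
      using \<delta>(2)[OF y(1)] y(3) \<sigma>x by simp
    then have "\<sigma> y \<notin> N" using \<epsilon>(2) by (auto simp: dist_commute)
    moreover have "\<sigma> y \<in> (\<Union>B\<in>D. convex hull (dehom ` B))"
      using image y(1) union by blast
    ultimately have \<sigma>y: "\<sigma> y \<in> convex hull (dehom ` A)"
      by (auto simp: N_def)
    show ?thesis
      by (rule Gcd_heights_dvd[OF uni[OF A(1)] pos[OF A(1)] \<sigma>y Z_map_denominator[OF \<sigma> y(1,2)]])
  qed
  \<comment> \<open>Two consecutive large values of \<open>q\<close> leave 1 as the only common
    divisor.\<close>
  obtain q where q: "real CARD('n) / \<delta> < real q"
    using reals_Archimedean2 by blast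
  then have "Gcd ((\<lambda>v. nat (v $ None)) ` A) dvd q" "Gcd ((\<lambda>v. nat (v $ None)) ` A) dvd Suc q"
    by (auto intro!: dvd)
  then have "Gcd ((\<lambda>v. nat (v $ None)) ` A) dvd Suc q - q"
    by (intro dvd_diff_nat)
  then show ?thesis by simp
qed

theorem theorem3p5:
  fixes P :: "(real ^ 'n) set"
  assumes "cube_polyhedron P"
    and "Z_retract_of P unit_cube"
  shows "contractible P \<and>
    (\<exists>v\<in>P. v \<in> vertices unit_cube) \<and>
    (\<exists>K. strongly_regular_triangulation K P)"
proof -
  obtain \<sigma> where \<sigma>: "Z_map unit_cube unit_cube \<sigma>" "\<And>x. x \<in> unit_cube \<Longrightarrow> \<sigma> (\<sigma> x) = \<sigma> x"
    and image: "P = \<sigma> ` unit_cube"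
    using assms(2) unfolding Z_retract_of_def Z_retraction_def by blast
  have maps: "\<sigma> ` unit_cube \<subseteq> unit_cube" using \<sigma>(1) by (simp add: Z_map_def)
  have P: "P = {x \<in> unit_cube. \<sigma> x = x}"
  proof
    show "P \<subseteq> {x \<in> unit_cube. \<sigma> x = x}" using image maps \<sigma>(2) by auto
    show "{x \<in> unit_cube. \<sigma> x = x} \<subseteq> P" unfolding image by (auto intro: rev_image_eqI)
  qed
  have cont: "continuous_on unit_cube \<sigma>" using \<sigma>(1) by (rule Z_map_continuous_on)
  have "retraction unit_cube P \<sigma>"
    unfolding retraction_def using cont P image by auto
  then have "P retract_of unit_cube" unfolding retract_of_def by blast
  then have contr: "contractible P"
    using retract_of_contractible convex_imp_contractible convex_box(1) by blast
  have zero: "(0 :: real ^ 'n) \<in> unit_cube" by (simp add: mem_unit_cube)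
  then have vP: "\<sigma> 0 \<in> P" using image by blast
  have "\<sigma> 0 \<in> vertices unit_cube"
  proof (rule integer_point_vertex)
    show "\<sigma> 0 \<in> unit_cube" using vP P by blast
    \<comment> \<open>Integrality is the case of denominator 1.\<close>
    show "\<sigma> 0 $ i \<in> \<int>" for i
      using Z_map_denominator[OF \<sigma>(1) zero, of 1 i] by simp
  qed
  then have vert: "\<exists>v\<in>P. v \<in> vertices unit_cube" using vP by blast
  obtain C D where C: "regular_fan C" and D: "D \<subseteq> C" "\<And>A B. A \<in> D \<Longrightarrow> B \<subseteq> A \<Longrightarrow> B \<in> D"
    and pos: "\<And>A v. A \<in> D \<Longrightarrow> v \<in> A \<Longrightarrow> 0 < v $ None"
    and union: "(\<Union>A\<in>D. convex hull (dehom ` A)) = P"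
    using Z_retract_fan[OF \<sigma>(1) P] by metis
  have uni: "unimodular A" if "A \<in> D" for A
    using that D(1) regular_fan_unimodular[OF C] by blast
  have vert_hull: "vertices (convex hull (dehom ` A)) = dehom ` A" if "A \<in> D" for A
    using uni[OF that] pos[OF that] by (rule vertices_hull_dehom)
  define K where "K = (\<lambda>A. convex hull (dehom ` A)) ` D"
  have "simplicial_complex K"
    unfolding K_def
    by (rule simplicial_complex_hulls_dehom[OF C D(1)]) (erule (1) D(2), erule (1) pos)
  then have "triangulates K P"
    using union by (simp add: triangulates_def K_def)
  moreover have "regular_simplex S" if S: "S \<in> K" for S
  proof -
    obtain A where A: "A \<in> D" "S = convex hull (dehom ` A)"
      using S by (auto simp: K_def)
    then have "S \<subseteq> unit_cube" using union P by blast
    then show ?thesis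
      using regular_simplex_hull_dehom[OF uni[OF A(1)] pos[OF A(1)]] by (simp add: A(2))
  qed
  moreover have "Gcd (den ` vertices S) = 1" if S: "S \<in> K" "\<forall>T\<in>K. S \<subseteq> T \<longrightarrow> T = S" for S
  proof -
    obtain A where A: "A \<in> D" "S = convex hull (dehom ` A)"
      using S(1) by (auto simp: K_def)
    have hull_le: "convex hull (dehom ` A) \<subseteq> convex hull (dehom ` B)" if "A \<subseteq> B" for B
      using that by (intro hull_mono image_mono)
    \<comment> \<open>Maximality passes from simplexes to cones: a simplex determines its vertices,
      and these determine the generators because \<open>dehom\<close> is injective on
      \<open>B\<close>.\<close>
    have max: "B = A" if B: "B \<in> D" "A \<subseteq> B" for B
    proof -
      have "convex hull (dehom ` B) = S"
        using S(2) B(1) hull_le[OF B(2)] by (auto simp: K_def A(2))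
      then have "dehom ` B = dehom ` A"
        using vert_hull[OF A(1)] vert_hull[OF B(1)] by (simp add: A(2))
      then show ?thesis
        using inj_on_dehom[OF uni[OF B(1)] pos[OF B(1)]] B(2) by (metis inj_on_image_eq_iff subset_refl)
    qed
    \<comment> \<open>The empty cone lies below every cone of \<open>D\<close>. If it were maximal,
      all simplexes would be empty, although one of them contains \<open>\<sigma> 0\<close>.\<close>
    have "A \<noteq> {}"
    proof
      assume "A = {}"
      obtain B where "B \<in> D" "\<sigma> 0 \<in> convex hull (dehom ` B)" using union vP by blast
      then show False using max[of B] \<open>A = {}\<close> by auto
    qed
    have "den ` vertices S = den ` dehom ` A"
      unfolding A(2) vert_hull[OF A(1)] ..
    also have "\<dots> = (\<lambda>v. nat (v $ None)) ` A"
      unfolding image_image by (intro image_cong refl den_dehom[OF uni[OF A(1)]] pos[OF A(1)])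
    moreover have "Gcd ((\<lambda>v. nat (v $ None)) ` A) = 1"
      by (rule Gcd_heights_maximal[OF \<sigma>(1) P _ C D(1) _ _ union A(1) \<open>A \<noteq> {}\<close>])
        (use image in simp, erule (1) D(2), erule (1) pos, erule (1) max)
    ultimately show ?thesis by simp
  qed
  ultimately have "strongly_regular_triangulation K P"
    unfolding strongly_regular_triangulation_def regular_triangulation_def by blast
  then show ?thesis using contr vert by blast
qed

end
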